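(* Consider the deterministic occupancy-ADMM described in the context. Assume $\theta\mapsto K_\theta$ is $L_K$-Lipschitz on $\Theta$, $D_\theta K_\theta$ is bounded on the visited set, and the occupancy reduced objective $\phi(\theta)+c_x^{\mathsf T}K_\theta^{-1}b$ is bounded below on $\Theta$. Let $\kappa_K=\sup_\theta\|K_\theta^{-1}\|<\infty$, $A=3\kappa_K^4L_K^2\|c_x\|^2$, $B=3\kappa_K^2/\eta_x^2$, and suppose $\frac B\beta<\tau<\frac1{2\eta_x}-\frac B\beta$; that $0<\underline\eta\le\eta_{\theta,k}$; that the smooth augmented policy gradients $\nabla h_k$ are $L_{\theta,k}$-Lipschitz on every policy comparison segment $[\theta^k,\theta^{k+1}]$ with $L_{\theta,k}\le\overline L<\infty$; and that $\frac1{2\eta_{\theta,k}}-\frac{L_{\theta,k}}2-\frac A\beta\ge\alpha_\theta>0$ for all $k$. Then the corrected Lyapunov function $\Phi_k^C=\mathcal L_\beta(\theta^k,x^k,y^k)+\tau\|\Delta x_k\|^2$ has positive one-step decrease: there are $c_\theta,c_x,c_x'>0$ with $$\Phi_k^C-\Phi_{k+1}^C\ge c_\theta\|\Delta\theta_{k+1}\|^2+c_x\|\Delta x_{k+1}\|^2+c_x'\|\Delta x_k\|^2\qquad(k\ge1).$$ Consequently the true occupancy KKT residual converges to zero, $G^C(\theta^k,x^k,y^k)\to0$.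
   Context: Norms are Euclidean/spectral. $(\mathcal S,\mathcal A,P,r,\rho,\gamma)$ is a finite discounted MDP with $0<\gamma<1$ and initial distribution $\rho$. $\Theta\subset\mathbb R^p$ is closed and convex, $\theta\mapsto\pi_\theta$ is a smooth policy map on a neighborhood of $\Theta$. $\psi_\Theta=\phi+\delta_\Theta$ ($\delta_\Theta$ the indicator) is proper, lower semicontinuous, bounded below; $\partial\psi_\Theta$ is the limiting subdifferential. Variables: $x=(q,d)$ with $q\in\mathbb R^{|\mathcal S||\mathcal A|}$, $d\in\mathbb R^{|\mathcal S|}$. $(P^{\mathsf T}q)(s')=\sum_{s,a}P(s'|s,a)q(s,a)$; $(\Pi_\theta d)(s,a)=\pi_\theta(a|s)d(s)$; $$K_\theta=\begin{bmatrix}-\gamma P^{\mathsf T} & I \\ I & -\Pi_\theta\end{bmatrix},\quad b=\begin{bmatrix}(1-\gamma)\rho \\ 0\end{bmatrix},\quad c_x=\begin{bmatrix}-r/(1-\gamma) \\ 0\end{bmatrix}.$$ ($K_\theta$ is invertible with uniformly bounded inverse.) The problem is $\min_{\theta\in\Theta,x}\phi(\theta)+c_x^{\mathsf T}x$ s.t. $K_\theta x=b$; $\mathcal L_\beta(\theta,x,y)=\phi(\theta)+c_x^{\mathsf T}x+\langle y,K_\theta x-b\rangle+\frac\beta2\|K_\theta x-b\|^2$. Squared KKT residual: $G^C(\theta,x,y)=\operatorname{dist}^2(0,\partial\psi_\Theta(\theta)+D_\theta(K_\theta x)^{\mathsf T}y)+\|c_x+K_\theta^{\mathsf T}y\|^2+\|K_\theta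 x-b\|^2$. Algorithm ($\beta,\eta_x,\eta_{\theta,k}>0$), from $\theta^0\in\operatorname{dom}\psi_\Theta$ and finite $x^0,y^0$: with $h_k(\theta)=\langle y^k,K_\theta x^k-b\rangle+\frac\beta2\|K_\theta x^k-b\|^2$, for $k\ge0$, $\theta^{k+1}\in\arg\min_{\theta\in\Theta}\{\phi(\theta)+\langle\nabla h_k(\theta^k),\theta-\theta^k\rangle+\frac1{2\eta_{\theta,k}}\|\theta-\theta^k\|^2\}$; $x^{k+1}=\arg\min_x\{\mathcal L_\beta(\theta^{k+1},x,y^k)+\frac1{2\eta_x}\|x-x^k\|^2\}$; $y^{k+1}=y^k+\beta(K_{\theta^{k+1}}x^{k+1}-b)$. $\Delta\theta_{k+1}=\theta^{k+1}-\theta^k$, $\Delta x_{k+1}=x^{k+1}-x^k$. *)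

theory Defs
  imports "HOL-Analysis.Analysis"
begin

section \<open>Extended-valued functions and limiting subgradients\<close>

definition set_ind :: "'a set \<Rightarrow> 'a \<Rightarrow> ereal" where
  "set_ind C x = (if x \<in> C then 0 else \<infinity>)"

text \<open>Outside \<open>C\<close> the value is \<open>\<infinity>\<close> whatever \<open>f\<close> is there, since \<open>a + \<infinity> = \<infinity>\<close> for every \<open>a :: ereal\<close>.\<close>

definition restrict_ext :: "('a \<Rightarrow> ereal) \<Rightarrow> 'a set \<Rightarrow> 'a \<Rightarrow> ereal" where
  "restrict_ext f C x = f x + set_ind C x"

definition edom :: "('a \<Rightarrow> ereal) \<Rightarrow> 'a set" where
  "edom f = {x. f x < \<infinity>}"

definition proper :: "('a \<Rightarrow> ereal) \<Rightarrow> bool" where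
  "proper f \<longleftrightarrow> (\<forall>x. f x \<noteq> -\<infinity>) \<and> edom f \<noteq> {}"

definition lsc :: "('a::topological_space \<Rightarrow> ereal) \<Rightarrow> bool" where
  "lsc f \<longleftrightarrow> (\<forall>x. f x \<le> Liminf (at x) f)"

definition bounded_below_on :: "'a set \<Rightarrow> ('a \<Rightarrow> ereal) \<Rightarrow> bool" where
  "bounded_below_on C f \<longleftrightarrow> (\<exists>m::real. \<forall>x\<in>C. ereal m \<le> f x)"

definition regular_subdiff :: "('a::real_inner \<Rightarrow> ereal) \<Rightarrow> 'a \<Rightarrow> 'a set" where
  "regular_subdiff f x =
     {v. \<bar>f x\<bar> \<noteq> \<infinity> \<and>
         0 \<le> Liminf (at x) (\<lambda>z. (f z - f x - ereal (v \<bullet> (z - x))) / ereal (norm (z - x)))}"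

definition limiting_subdiff :: "('a::real_inner \<Rightarrow> ereal) \<Rightarrow> 'a \<Rightarrow> 'a set" where
  "limiting_subdiff f x =
     {v. \<bar>f x\<bar> \<noteq> \<infinity> \<and>
         (\<exists>xs vs. xs \<longlonglongrightarrow> x \<and> (\<lambda>n. f (xs n)) \<longlonglongrightarrow> f x \<and>
                  (\<forall>n. vs n \<in> regular_subdiff f (xs n)) \<and> vs \<longlonglongrightarrow> v)}"

text \<open>Unlike \<^const>\<open>infdist\<close>, the distance to the empty set is \<open>\<infinity>\<close>, so a residual cannot
  vanish merely because a subdifferential is empty.\<close>

definition ext_infdist :: "'a::metric_space \<Rightarrow> 'a set \<Rightarrow> ereal" where
  "ext_infdist x S = (INF v\<in>S. ereal (dist x v))"

definition grad :: "('a::real_inner \<Rightarrow> real) \<Rightarrow> 'a \<Rightarrow> 'a" where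
  "grad f x = (THE g. GDERIV f x :> g)"

definition C1_on :: "'a::real_normed_vector set \<Rightarrow> ('a \<Rightarrow> 'b::real_normed_vector) \<Rightarrow> bool" where
  "C1_on U f \<longleftrightarrow>
     (\<exists>D :: 'a \<Rightarrow> 'a \<Rightarrow>\<^sub>L 'b. (\<forall>x\<in>U. (f has_derivative blinfun_apply (D x)) (at x)) \<and> continuous_on U D)"

section \<open>Finite discounted MDPs and the occupancy operator\<close>

definition prob_vec :: "('i::finite \<Rightarrow> real) \<Rightarrow> bool" where
  "prob_vec p \<longleftrightarrow> (\<forall>i. 0 \<le> p i) \<and> (\<Sum>i\<in>UNIV. p i) = 1"

text \<open>\<open>P s a s'\<close> is the transition probability \<open>P(s'|s,a)\<close>.\<close>

definition finite_mdp :: "('s::finite \<Rightarrow> 'a::finite \<Rightarrow> 's \<Rightarrow> real) \<Rightarrow> ('s \<Rightarrow> real) \<Rightarrow> real \<Rightarrow> bool" where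
  "finite_mdp P \<rho> \<gamma> \<longleftrightarrow> (\<forall>s a. prob_vec (P s a)) \<and> prob_vec \<rho> \<and> 0 < \<gamma> \<and> \<gamma> < 1"

text \<open>\<open>\<pi> \<theta> s a\<close> is \<open>\<pi>\<^sub>\<theta>(a|s)\<close>. The map is \<open>C\<^sup>1\<close> on an open neighbourhood of \<open>\<Theta>\<close>, but only the
  parameters in \<open>\<Theta>\<close> have to give probability distributions, so that the direct
  parametrisation (\<open>\<Theta>\<close> a product of simplices) is covered.\<close>

definition smooth_policy_map ::
  "'p::real_normed_vector set \<Rightarrow> ('p \<Rightarrow> 's::finite \<Rightarrow> 'a::finite \<Rightarrow> real) \<Rightarrow> bool" where
  "smooth_policy_map \<Theta> \<pi> \<longleftrightarrow>
     (\<forall>\<theta>\<in>\<Theta>. \<forall>s. prob_vec (\<pi> \<theta> s)) \<and>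
     (\<exists>U. open U \<and> \<Theta> \<subseteq> U \<and> (\<forall>s a. C1_on U (\<lambda>\<theta>. \<pi> \<theta> s a)))"

definition PT :: "('s::finite \<Rightarrow> 'a::finite \<Rightarrow> 's \<Rightarrow> real) \<Rightarrow> real^('s \<times> 'a) \<Rightarrow> real^'s" where
  "PT P q = (\<chi> s'. \<Sum>s\<in>UNIV. \<Sum>a\<in>UNIV. P s a s' * q $ (s, a))"

definition Pi_op :: "('s::finite \<Rightarrow> 'a::finite \<Rightarrow> real) \<Rightarrow> real^'s \<Rightarrow> real^('s \<times> 'a)" where
  "Pi_op p d = (\<chi> sa. p (fst sa) (snd sa) * d $ fst sa)"

definition occ_map ::
  "real \<Rightarrow> ('s::finite \<Rightarrow> 'a::finite \<Rightarrow> 's \<Rightarrow> real) \<Rightarrow> ('s \<Rightarrow> 'a \<Rightarrow> real) \<Rightarrow>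
   (real^('s \<times> 'a)) \<times> (real^'s) \<Rightarrow> (real^'s) \<times> (real^('s \<times> 'a))" where
  "occ_map \<gamma> P p x = (- (\<gamma> *\<^sub>R PT P (fst x)) + snd x, fst x - Pi_op p (snd x))"

text \<open>The block matrix \<open>K\<^sub>\<theta>\<close>, as a bounded linear map on \<open>x = (q, d)\<close>; its norm is the spectral norm.\<close>

definition occ_K ::
  "real \<Rightarrow> ('s::finite \<Rightarrow> 'a::finite \<Rightarrow> 's \<Rightarrow> real) \<Rightarrow> ('p \<Rightarrow> 's \<Rightarrow> 'a \<Rightarrow> real) \<Rightarrow> 'p \<Rightarrow>
   ((real^('s \<times> 'a)) \<times> (real^'s)) \<Rightarrow>\<^sub>L ((real^'s) \<times> (real^('s \<times> 'a)))" where
  "occ_K \<gamma> P \<pi> \<theta> = Blinfun (occ_map \<gamma> P (\<pi> \<theta>))"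

definition occ_b :: "real \<Rightarrow> ('s::finite \<Rightarrow> real) \<Rightarrow> (real^'s) \<times> (real^('s \<times> 'a::finite))" where
  "occ_b \<gamma> \<rho> = ((1 - \<gamma>) *\<^sub>R (\<chi> s. \<rho> s), 0)"

definition occ_c :: "real \<Rightarrow> ('s::finite \<Rightarrow> 'a::finite \<Rightarrow> real) \<Rightarrow> (real^('s \<times> 'a)) \<times> (real^'s)" where
  "occ_c \<gamma> r = (\<chi> sa. - (r (fst sa) (snd sa) / (1 - \<gamma>)), 0)"

section \<open>Augmented Lagrangian and KKT residual\<close>

definition aug_term ::
  "('p \<Rightarrow> 'x::real_inner \<Rightarrow>\<^sub>L 'y::real_inner) \<Rightarrow> 'y \<Rightarrow> real \<Rightarrow> 'x \<Rightarrow> 'y \<Rightarrow> 'p \<Rightarrow> real" where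
  "aug_term K b \<beta> x y \<theta> = y \<bullet> (blinfun_apply (K \<theta>) x - b) + \<beta> / 2 * (norm (blinfun_apply (K \<theta>) x - b))\<^sup>2"

definition aug_lagrangian ::
  "('p \<Rightarrow> ereal) \<Rightarrow> 'x::real_inner \<Rightarrow> ('p \<Rightarrow> 'x \<Rightarrow>\<^sub>L 'y::real_inner) \<Rightarrow> 'y \<Rightarrow> real \<Rightarrow> 'p \<Rightarrow> 'x \<Rightarrow> 'y \<Rightarrow> ereal" where
  "aug_lagrangian \<phi> c K b \<beta> \<theta> x y = \<phi> \<theta> + ereal (c \<bullet> x + aug_term K b \<beta> x y \<theta>)"

definition kkt_residual ::
  "('p::real_inner \<Rightarrow> ereal) \<Rightarrow> 'p set \<Rightarrow> 'x::real_inner \<Rightarrow> ('p \<Rightarrow> 'x \<Rightarrow>\<^sub>L 'y::real_inner) \<Rightarrow> 'y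
     \<Rightarrow> 'p \<Rightarrow> 'x \<Rightarrow> 'y \<Rightarrow> ereal" where
  "kkt_residual \<phi> \<Theta> c K b \<theta> x y =
     (ext_infdist 0
        ((\<lambda>v. v + adjoint (frechet_derivative (\<lambda>t. blinfun_apply (K t) x) (at \<theta>)) y) `
           limiting_subdiff (restrict_ext \<phi> \<Theta>) \<theta>))\<^sup>2
     + ereal ((norm (c + adjoint (blinfun_apply (K \<theta>)) y))\<^sup>2)
     + ereal ((norm (blinfun_apply (K \<theta>) x - b))\<^sup>2)"

section \<open>The operator is well defined, and its inverses are uniformly bounded\<close>

lemma bounded_linear_occ_map: "bounded_linear (occ_map \<gamma> P p)"
proof (rule linear_conv_bounded_linear[THEN iffD1], rule linearI)
  show "occ_map \<gamma> P p (x + y) = occ_map \<gamma> P p x + occ_map \<gamma> P p y" for x y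
    by (simp add: occ_map_def PT_def Pi_op_def vec_eq_iff sum.distrib algebra_simps)
  show "occ_map \<gamma> P p (c *\<^sub>R x) = c *\<^sub>R occ_map \<gamma> P p x" for c x
    by (simp add: occ_map_def PT_def Pi_op_def vec_eq_iff sum_distrib_left algebra_simps)
qed

lemma occ_K_apply: "blinfun_apply (occ_K \<gamma> P \<pi> \<theta>) x = occ_map \<gamma> P (\<pi> \<theta>) x"
  by (simp add: occ_K_def bounded_linear_Blinfun_apply bounded_linear_occ_map)

lemma prob_vec_sum_mult: "prob_vec p \<Longrightarrow> (\<Sum>i\<in>UNIV. p i * t) = t"
  by (simp add: prob_vec_def flip: sum_distrib_right)

lemma sum_abs_PT_le:
  assumes "\<And>s a. prob_vec (P s a)"
  shows "(\<Sum>s\<in>UNIV. \<bar>PT P q $ s\<bar>) \<le> (\<Sum>sa\<in>UNIV. \<bar>q $ sa\<bar>)"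
proof -
  have nn: "0 \<le> P s a s'" for s a s'
    using assms by (simp add: prob_vec_def)
  have "(\<Sum>s'\<in>UNIV. \<bar>PT P q $ s'\<bar>) \<le> (\<Sum>s'\<in>UNIV. \<Sum>s\<in>UNIV. \<Sum>a\<in>UNIV. P s a s' * \<bar>q $ (s, a)\<bar>)"
  proof (rule sum_mono)
    fix s'
    have "\<bar>PT P q $ s'\<bar> \<le> (\<Sum>s\<in>UNIV. \<bar>\<Sum>a\<in>UNIV. P s a s' * q $ (s, a)\<bar>)"
      by (simp add: PT_def)
    also have "\<dots> \<le> (\<Sum>s\<in>UNIV. \<Sum>a\<in>UNIV. \<bar>P s a s' * q $ (s, a)\<bar>)"
      by (intro sum_mono sum_abs)
    also have "\<dots> = (\<Sum>s\<in>UNIV. \<Sum>a\<in>UNIV. P s a s' * \<bar>q $ (s, a)\<bar>)"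
      using nn by (simp add: abs_mult)
    finally show "\<bar>PT P q $ s'\<bar> \<le> (\<Sum>s\<in>UNIV. \<Sum>a\<in>UNIV. P s a s' * \<bar>q $ (s, a)\<bar>)" .
  qed
  also have "\<dots> = (\<Sum>s\<in>UNIV. \<Sum>s'\<in>UNIV. \<Sum>a\<in>UNIV. P s a s' * \<bar>q $ (s, a)\<bar>)"
    by (rule sum.swap)
  also have "\<dots> = (\<Sum>s\<in>UNIV. \<Sum>a\<in>UNIV. \<Sum>s'\<in>UNIV. P s a s' * \<bar>q $ (s, a)\<bar>)"
    by (rule sum.cong[OF refl], rule sum.swap)
  also have "\<dots> = (\<Sum>s\<in>UNIV. \<Sum>a\<in>UNIV. \<bar>q $ (s, a)\<bar>)"
    using assms by (simp add: prob_vec_sum_mult)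
  also have "\<dots> = (\<Sum>sa\<in>UNIV. \<bar>q $ sa\<bar>)"
    by (simp add: sum.cartesian_product)
  finally show ?thesis .
qed

lemma sum_abs_Pi_op:
  assumes "\<And>s. prob_vec (p s)"
  shows "(\<Sum>sa\<in>UNIV. \<bar>Pi_op p d $ sa\<bar>) = (\<Sum>s\<in>UNIV. \<bar>d $ s\<bar>)"
proof -
  have nn: "0 \<le> p s a" for s a
    using assms by (simp add: prob_vec_def)
  have "(\<Sum>sa\<in>UNIV. \<bar>Pi_op p d $ sa\<bar>) = (\<Sum>s\<in>UNIV. \<Sum>a\<in>UNIV. \<bar>Pi_op p d $ (s, a)\<bar>)"
    by (simp add: sum.cartesian_product)
  also have "\<dots> = (\<Sum>s\<in>UNIV. \<Sum>a\<in>UNIV. p s a * \<bar>d $ s\<bar>)"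
    using nn by (simp add: Pi_op_def abs_mult)
  also have "\<dots> = (\<Sum>s\<in>UNIV. \<bar>d $ s\<bar>)"
    using assms by (simp add: prob_vec_sum_mult)
  finally show ?thesis .
qed

lemma norm_le_occ_map:
  fixes P :: "'s::finite \<Rightarrow> 'a::finite \<Rightarrow> 's \<Rightarrow> real"
  assumes P: "\<And>s a. prob_vec (P s a)" and p: "\<And>s. prob_vec (p s)"
    and \<gamma>: "0 < \<gamma>" "\<gamma> < 1"
  shows "norm x \<le> 3 * (real CARD('s) + real CARD('s \<times> 'a)) / (1 - \<gamma>) * norm (occ_map \<gamma> P p x)"
proof -
  define n where "n = real CARD('s) + real CARD('s \<times> 'a)"
  obtain q d where x: "x = (q, d)" by (cases x)
  obtain u v where uv: "occ_map \<gamma> P p x = (u, v)" by (cases "occ_map \<gamma> P p x")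
  have d: "d = u + \<gamma> *\<^sub>R PT P q" and q: "q = v + Pi_op p d"
    using uv by (auto simp: occ_map_def x)
  define Q where "Q = (\<Sum>i\<in>UNIV. \<bar>q $ i\<bar>)"
  define D where "D = (\<Sum>i\<in>UNIV. \<bar>d $ i\<bar>)"
  define M where "M = (\<Sum>i\<in>UNIV. \<bar>u $ i\<bar>) + (\<Sum>i\<in>UNIV. \<bar>v $ i\<bar>)"
  have Q0: "0 \<le> Q" by (simp add: Q_def sum_nonneg)
  have M0: "0 \<le> M" by (simp add: M_def sum_nonneg)
  have "D \<le> (\<Sum>i\<in>UNIV. \<bar>u $ i\<bar> + \<gamma> * \<bar>PT P q $ i\<bar>)"
    unfolding D_def
  proof (rule sum_mono)
    fix i
    have "d $ i = u $ i + \<gamma> * PT P q $ i" by (subst d) simp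
    then have "\<bar>d $ i\<bar> \<le> \<bar>u $ i\<bar> + \<bar>\<gamma> * PT P q $ i\<bar>" by linarith
    then show "\<bar>d $ i\<bar> \<le> \<bar>u $ i\<bar> + \<gamma> * \<bar>PT P q $ i\<bar>" using \<gamma> by (simp add: abs_mult)
  qed
  also have "\<dots> = (\<Sum>i\<in>UNIV. \<bar>u $ i\<bar>) + \<gamma> * (\<Sum>i\<in>UNIV. \<bar>PT P q $ i\<bar>)"
    by (simp add: sum.distrib sum_distrib_left)
  also have "\<dots> \<le> (\<Sum>i\<in>UNIV. \<bar>u $ i\<bar>) + \<gamma> * Q"
    using sum_abs_PT_le[of P q, OF P] \<gamma> by (simp add: Q_def)
  finally have D1: "D \<le> (\<Sum>i\<in>UNIV. \<bar>u $ i\<bar>) + \<gamma> * Q" .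
  have "Q \<le> (\<Sum>i\<in>UNIV. \<bar>v $ i\<bar> + \<bar>Pi_op p d $ i\<bar>)"
    unfolding Q_def by (rule sum_mono, subst q) simp
  also have "\<dots> = (\<Sum>i\<in>UNIV. \<bar>v $ i\<bar>) + D"
    using sum_abs_Pi_op[of p d, OF p] by (simp add: D_def sum.distrib)
  finally have Q1: "Q \<le> (\<Sum>i\<in>UNIV. \<bar>v $ i\<bar>) + D" .
  have QM: "(1 - \<gamma>) * Q \<le> M" using D1 Q1 by (simp add: M_def algebra_simps)
  have "\<gamma> * Q \<le> 1 * Q" using \<gamma> Q0 by (intro mult_right_mono) auto
  moreover have "(\<Sum>i\<in>UNIV. \<bar>u $ i\<bar>) \<le> M" by (simp add: M_def sum_nonneg)
  ultimately have DM: "D \<le> M + Q" using D1 by linarith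
  have "(1 - \<gamma>) * M \<le> 1 * M" using \<gamma> M0 by (intro mult_right_mono) auto
  then have "(1 - \<gamma>) * (Q + D) \<le> 3 * M"
    using QM mult_left_mono[OF DM, of "1 - \<gamma>"] \<gamma> by (simp add: distrib_left)
  then have QD: "Q + D \<le> 3 * M / (1 - \<gamma>)"
    using \<gamma> by (simp add: field_simps)
  have "norm x \<le> norm q + norm d" by (simp add: x norm_Pair_le)
  also have "\<dots> \<le> Q + D"
    unfolding Q_def D_def by (intro add_mono norm_le_l1_cart)
  also note QD
  finally have 1: "norm x \<le> 3 * M / (1 - \<gamma>)" .
  have "norm u \<le> norm (u, v)" "norm v \<le> norm (u, v)"
    using norm_fst_le[of "u" "v"] norm_snd_le[of "v" "u"] by auto
  then have "\<bar>u $ i\<bar> \<le> norm (u, v)" "\<bar>v $ j\<bar> \<le> norm (u, v)" for i j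
    using component_le_norm_cart[of u i] component_le_norm_cart[of v j] by linarith+
  then have "M \<le> real CARD('s) * norm (u, v) + real CARD('s \<times> 'a) * norm (u, v)"
    unfolding M_def by (intro add_mono sum_bounded_above) auto
  then have "M \<le> n * norm (u, v)" by (simp add: n_def algebra_simps)
  then have "3 * M / (1 - \<gamma>) \<le> 3 * (n * norm (u, v)) / (1 - \<gamma>)"
    using \<gamma> by (intro divide_right_mono) auto
  also have "\<dots> = 3 * n / (1 - \<gamma>) * norm (occ_map \<gamma> P p x)" by (simp add: uv)
  finally show ?thesis using 1 unfolding n_def by linarith
qed

lemma bij_occ_K:
  fixes P :: "'s::finite \<Rightarrow> 'a::finite \<Rightarrow> 's \<Rightarrow> real"
  assumes "finite_mdp P \<rho> \<gamma>" and "smooth_policy_map \<Theta> \<pi>" and "\<theta> \<in> \<Theta>"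
  shows "bij (blinfun_apply (occ_K \<gamma> P \<pi> \<theta>))"
proof -
  let ?K = "blinfun_apply (occ_K \<gamma> P \<pi> \<theta>)"
  have P: "prob_vec (P s a)" and g: "0 < \<gamma>" "\<gamma> < 1" and p: "prob_vec (\<pi> \<theta> s)" for s a
    using assms by (auto simp: finite_mdp_def smooth_policy_map_def)
  have lin: "linear ?K" by (simp add: blinfun.bounded_linear_right bounded_linear.linear)
  have inj: "inj ?K"
  proof (subst linear_injective_0[OF lin], intro allI impI)
    fix x assume "?K x = 0"
    then show "x = 0"
      using norm_le_occ_map[of P "\<pi> \<theta>" \<gamma> x, OF P p g] by (simp add: occ_K_apply)
  qed
  have "DIM((real^('s \<times> 'a)) \<times> (real^'s)) = DIM((real^'s) \<times> (real^('s \<times> 'a)))"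
    by simp
  then have "surj ?K"
    using lin inj by (intro linear_injective_imp_surjective) auto
  with inj show ?thesis by (simp add: bij_def)
qed

lemma bdd_above_inv_occ_K:
  fixes P :: "'s::finite \<Rightarrow> 'a::finite \<Rightarrow> 's \<Rightarrow> real"
  assumes "finite_mdp P \<rho> \<gamma>" and "smooth_policy_map \<Theta> \<pi>"
  shows "bdd_above ((\<lambda>\<theta>. onorm (inv (blinfun_apply (occ_K \<gamma> P \<pi> \<theta>)))) ` \<Theta>)"
proof (rule bdd_aboveI2)
  fix \<theta> assume \<theta>: "\<theta> \<in> \<Theta>"
  let ?K = "blinfun_apply (occ_K \<gamma> P \<pi> \<theta>)"
  have P: "prob_vec (P s a)" and g: "0 < \<gamma>" "\<gamma> < 1" and p: "prob_vec (\<pi> \<theta> s)" for s a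
    using assms \<theta> by (auto simp: finite_mdp_def smooth_policy_map_def)
  have surj: "surj ?K" using bij_occ_K[OF assms \<theta>] by (simp add: bij_def)
  show "onorm (inv ?K) \<le> 3 * (real CARD('s) + real CARD('s \<times> 'a)) / (1 - \<gamma>)"
  proof (rule onorm_le)
    fix y
    show "norm (inv ?K y) \<le> 3 * (real CARD('s) + real CARD('s \<times> 'a)) / (1 - \<gamma>) * norm y"
      using norm_le_occ_map[of P "\<pi> \<theta>" \<gamma> "inv ?K y", OF P p g] surj_f_inv_f[OF surj, of y]
      unfolding occ_K_apply by simp
  qed
qed

end

theory Submission
  imports Defs
begin

text \<open>
  Optimality of the \<open>x\<close>-step and the multiplier update give \<open>K\<^sup>T y = - c - \<Delta>x / \<eta>x\<close> after every
  iteration, so the multiplier is a Lipschitz function of \<open>\<theta>\<close> and the last \<open>x\<close>-increment, and the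
  ascent \<open>\<parallel>\<Delta>y\<parallel>\<^sup>2 / \<beta>\<close> of the dual step is paid for by the proximal decrease of the two primal steps
  together with the \<open>\<tau>\<close>-correction. Eliminating \<open>y\<close> by the same identity bounds the Lagrangian
  below by the reduced objective up to a multiple of \<open>\<parallel>\<Delta>x\<parallel>\<^sup>2\<close>. Hence the Lyapunov function converges,
  all increments vanish, and each part of the KKT residual is bounded by increments.
\<close>

section \<open>Descent and subgradients\<close>

lemma is_arg_min_le:
  fixes f :: "'a \<Rightarrow> 'b::linorder"
  assumes "is_arg_min f P z" "P w" shows "f z \<le> f w"
  using assms by (auto simp: is_arg_min_def not_less)

text \<open>Restricting \<open>f\<close> to the segment makes this a one-variable monotonicity
  argument; smoothness is assumed on the segment alone, matching the hypothesis on the policy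
  comparison segments.\<close>

lemma descent_lemma:
  fixes f :: "'a::real_inner \<Rightarrow> real"
  assumes f: "\<And>t. t \<in> closed_segment u v \<Longrightarrow> GDERIV f t :> g t"
    and g: "L-lipschitz_on (closed_segment u v) g"
  shows "f v \<le> f u + g u \<bullet> (v - u) + L / 2 * (norm (v - u))\<^sup>2"
proof -
  define p where "p s = u + s *\<^sub>R (v - u)" for s
  have p_mem: "p s \<in> closed_segment u v" if "0 \<le> s" "s \<le> 1" for s
    using that by (auto simp: p_def in_segment algebra_simps intro!: exI[of _ s])
  \<comment> \<open>The claim is \<open>G 1 \<le> G 0\<close>. The derivative of \<open>G\<close> at
    \<open>s\<close> is the gradient deviation in direction \<open>v - u\<close> minus its Lipschitz
    bound, hence nonpositive.\<close>
  define G where "G s = f (p s) - s * (g u \<bullet> (v - u)) - L / 2 * s\<^sup>2 * (norm (v - u))\<^sup>2" for s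
  have "G 1 \<le> G 0"
  proof (rule DERIV_nonpos_imp_nonincreasing[of 0 1 G])
    fix s :: real assume s: "0 \<le> s" "s \<le> 1"
    have p: "(p has_derivative (\<lambda>h. h *\<^sub>R (v - u))) (at s)"
      unfolding p_def by (auto intro!: derivative_eq_intros)
    have "(f has_derivative (\<lambda>h. h \<bullet> g (p s))) (at (p s))"
      using f[OF p_mem[OF s]] by (simp add: gderiv_def inner_commute)
    from has_derivative_compose[OF p this]
    have "((\<lambda>s. f (p s)) has_field_derivative (g (p s) \<bullet> (v - u))) (at s)"
      by (simp add: has_field_derivative_def inner_commute mult.commute[of _ "_ \<bullet> _"])
    then have D: "(G has_field_derivative (g (p s) \<bullet> (v - u) - g u \<bullet> (v - u) - L * s * (norm (v - u))\<^sup>2)) (at s)"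
      unfolding G_def by (auto intro!: derivative_eq_intros simp: power2_eq_square)
    have "(g (p s) - g u) \<bullet> (v - u) \<le> norm (g (p s) - g u) * norm (v - u)"
      by (rule norm_cauchy_schwarz)
    also have "\<dots> \<le> (L * norm (p s - u)) * norm (v - u)"
      using lipschitz_onD[OF g p_mem[OF s], of u]
      by (intro mult_right_mono) (auto simp: dist_norm)
    also have "\<dots> = L * s * (norm (v - u))\<^sup>2"
      using s by (simp add: p_def power2_eq_square)
    finally have "g (p s) \<bullet> (v - u) - g u \<bullet> (v - u) - L * s * (norm (v - u))\<^sup>2 \<le> 0"
      by (simp add: inner_diff_left)
    with D show "\<exists>y. (G has_real_derivative y) (at s) \<and> y \<le> 0" by blast
  qed simp
  then show ?thesis by (simp add: G_def p_def)
qed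

lemma grad_eq:
  assumes "GDERIV f t :> g" shows "grad f t = g"
  unfolding grad_def
proof (rule the_equality[where P = "\<lambda>g. GDERIV f t :> g"])
  fix g' assume "GDERIV f t :> g'"
  with assms have "(\<lambda>h. h \<bullet> g') = (\<lambda>h. h \<bullet> g)"
    unfolding gderiv_def by (metis has_derivative_unique)
  \<comment> \<open>The two derivatives are evaluated in the direction \<open>g' - g\<close>, which
    gives a vanishing square.\<close>
  then have "(g' - g) \<bullet> g' = (g' - g) \<bullet> g" by meson
  then have "(g' - g) \<bullet> (g' - g) = 0" by (simp add: inner_diff_right)
  then show "g' = g" by simp
qed (rule assms)

lemma regular_subdiff_subset_limiting: "regular_subdiff f z \<subseteq> limiting_subdiff f z"
proof
  fix v assume v: "v \<in> regular_subdiff f z"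
  then have "\<bar>f z\<bar> \<noteq> \<infinity>" by (simp add: regular_subdiff_def)
  with v show "v \<in> limiting_subdiff f z"
    unfolding limiting_subdiff_def
    by (intro CollectI conjI exI[of _ "\<lambda>_. z"] exI[of _ "\<lambda>_. v"]) auto
qed

text \<open>The quadratic minorant bounds the difference quotient below by
  \<open>- C * norm (w - z)\<close>, which tends to zero at \<open>z\<close>. Neither convexity nor
  smoothness of \<open>f\<close> enters.\<close>

lemma proximal_subgradient_regular:
  fixes f :: "'a::real_inner \<Rightarrow> ereal"
  assumes fin: "\<bar>f z\<bar> \<noteq> \<infinity>"
    and le: "\<And>w. f z + ereal (v \<bullet> (w - z) - C * (norm (w - z))\<^sup>2) \<le> f w"
  shows "v \<in> regular_subdiff f z"
proof -
  obtain a where a: "f z = ereal a" using fin by auto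
  \<comment> \<open>Three cases for \<open>f w\<close>: a finite value is divided through,
    \<open>-\<infinity>\<close> contradicts the minorant, and \<open>\<infinity>\<close> makes the
    quotient infinite.\<close>
  have *: "ereal (- C * norm (w - z)) \<le> (f w - f z - ereal (v \<bullet> (w - z))) / ereal (norm (w - z))"
    if "w \<noteq> z" for w
  proof (cases "f w")
    case (real e)
    have "a + (v \<bullet> (w - z) - C * (norm (w - z))\<^sup>2) \<le> e"
      using le[of w] by (simp add: a real)
    then show ?thesis using that by (simp add: a real field_simps power2_eq_square)
  next
    case MInf
    then show ?thesis using le[of w] by (simp add: a)
  qed (use that in \<open>simp add: a\<close>)
  have "0 \<le> Liminf (at z) (\<lambda>w. (f w - f z - ereal (v \<bullet> (w - z))) / ereal (norm (w - z)))"
    unfolding le_Liminf_iff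
  proof (intro allI impI)
    fix l :: ereal assume "l < 0"
    have "((\<lambda>w. - C * norm (w - z)) \<longlongrightarrow> - C * norm (z - z)) (at z)"
      by (intro tendsto_intros)
    then have "((\<lambda>w. ereal (- C * norm (w - z))) \<longlongrightarrow> 0) (at z)"
      by (simp add: zero_ereal_def)
    then have "\<forall>\<^sub>F w in at z. l < ereal (- C * norm (w - z))"
      using \<open>l < 0\<close> by (rule order_tendstoD(1))
    moreover have "\<forall>\<^sub>F w in at z. w \<noteq> z" by (simp add: eventually_at_filter)
    ultimately show "\<forall>\<^sub>F w in at z. l < (f w - f z - ereal (v \<bullet> (w - z))) / ereal (norm (w - z))"
      by eventually_elim (use * in \<open>force intro: less_le_trans\<close>)
  qed
  then show ?thesis using fin by (simp add: regular_subdiff_def)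
qed

lemma ext_infdist_nonneg: "0 \<le> ext_infdist z S"
  unfolding ext_infdist_def by (rule INF_greatest) simp

text \<open>Any single member of the set bounds the distance, and squaring is monotone because the
  distance is nonnegative.\<close>

lemma square_ext_infdist_le:
  assumes "v \<in> S" shows "(ext_infdist 0 S)\<^sup>2 \<le> ereal ((norm v)\<^sup>2)"
proof -
  have "ext_infdist 0 S \<le> ereal (norm v)"
    unfolding ext_infdist_def by (rule INF_lower2[OF assms]) simp
  then have "ext_infdist 0 S * ext_infdist 0 S \<le> ereal (norm v) * ereal (norm v)"
    by (intro ereal_mult_mono) (auto simp: ext_infdist_nonneg)
  then show ?thesis by (simp add: power2_eq_square)
qed

section \<open>Smoothness of the occupancy operator\<close>

text \<open>The operator is affine in the finitely many policy entries: \<open>?Z\<close> is its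
  value at the zero policy and \<open>E sa\<close> its increment for a unit entry at
  \<open>sa\<close>.\<close>

lemma differentiable_occ_K:
  fixes \<pi> :: "'p::real_normed_vector \<Rightarrow> 's::finite \<Rightarrow> 'a::finite \<Rightarrow> real"
  assumes "\<And>s a. (\<lambda>t. \<pi> t s a) differentiable at t"
  shows "occ_K \<gamma> P \<pi> differentiable at t"
proof -
  \<comment> \<open>The parameter \<open>t\<close> is a dummy here and in \<open>E\<close>, since
    the policies supplied are constant; so the same operators serve at every
    \<open>u\<close>.\<close>
  let ?Z = "occ_K \<gamma> P (\<lambda>_ _ _. 0) t"
  define E where "E sa = occ_K \<gamma> P (\<lambda>_ s a. of_bool ((s, a) = sa)) t - ?Z" for sa :: "'s \<times> 'a"
  have *: "occ_K \<gamma> P \<pi> = (\<lambda>t. ?Z + (\<Sum>sa\<in>UNIV. \<pi> t (fst sa) (snd sa) *\<^sub>R E sa))"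
  proof
    fix u
    show "occ_K \<gamma> P \<pi> u = ?Z + (\<Sum>sa\<in>UNIV. \<pi> u (fst sa) (snd sa) *\<^sub>R E sa)"
    proof (rule blinfun_eqI)
      fix z
      have E: "E sa z = (0, - Pi_op (\<lambda>s a. of_bool ((s, a) = sa)) (snd z))" for sa
        by (simp add: E_def blinfun.diff_left occ_K_apply occ_map_def Pi_op_def zero_vec_def)
      have "(\<Sum>sa\<in>UNIV. \<pi> u (fst sa) (snd sa) *\<^sub>R blinfun_apply (E sa) z) = (0, - Pi_op (\<pi> u) (snd z))"
        by (intro prod_eqI) (simp_all add: E fst_sum snd_sum vec_eq_iff Pi_op_def sum_negf of_bool_def
            if_distrib if_distribR cong: if_cong)
      then show "occ_K \<gamma> P \<pi> u z = (?Z + (\<Sum>sa\<in>UNIV. \<pi> u (fst sa) (snd sa) *\<^sub>R E sa)) z"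
        by (simp add: blinfun.add_left blinfun.sum_left blinfun.scaleR_left occ_K_apply occ_map_def
            Pi_op_def zero_vec_def)
    qed
  qed
  have "(\<lambda>t. \<pi> t (fst sa) (snd sa) *\<^sub>R E sa) differentiable at t" for sa
    by (rule differentiableI, rule bounded_linear.has_derivative[OF bounded_linear_scaleR_left],
        rule frechet_derivative_works[THEN iffD1], rule assms)
  then show ?thesis unfolding * by (intro derivative_intros differentiable_sum) auto
qed

lemma differentiable_smooth_policy_map:
  assumes "smooth_policy_map \<Theta> \<pi>" "t \<in> \<Theta>"
  shows "(\<lambda>t. \<pi> t s a) differentiable at t"
proof -
  obtain U where "t \<in> U" "C1_on U (\<lambda>\<theta>. \<pi> \<theta> s a)"
    using assms unfolding smooth_policy_map_def by blast
  then show ?thesis unfolding C1_on_def by (auto intro: differentiableI)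
qed

section \<open>Linearized ADMM with a parameter-dependent invertible operator\<close>

text \<open>Isolates the properties of the occupancy operator that drive the argument:
  differentiability, bijectivity, uniformly bounded inverses, Lipschitz dependence on the parameter.
  Step-size conditions beyond positivity come only with the convergence argument.\<close>

locale linearized_admm =
  fixes \<Theta> :: "'p::euclidean_space set"
    and \<phi> :: "'p \<Rightarrow> ereal"
    and K :: "'p \<Rightarrow> 'x::euclidean_space \<Rightarrow>\<^sub>L 'y::euclidean_space"
    and b :: 'y and c :: 'x
    and \<beta> \<eta>x :: real
    and \<eta>\<theta> :: "nat \<Rightarrow> real"
    and \<theta> :: "nat \<Rightarrow> 'p" and x :: "nat \<Rightarrow> 'x" and y :: "nat \<Rightarrow> 'y"
    and L\<^sub>K \<kappa> A B :: real
    and L :: "nat \<Rightarrow> real"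
  assumes K_differentiable: "\<And>t. t \<in> \<Theta> \<Longrightarrow> K differentiable at t"
    and bij_K: "\<And>t. t \<in> \<Theta> \<Longrightarrow> bij (K t)"
    and onorm_inv_K: "\<And>t. t \<in> \<Theta> \<Longrightarrow> onorm (inv (K t)) \<le> \<kappa>"
    and K_lipschitz: "L\<^sub>K-lipschitz_on \<Theta> K"
    and convex_Theta: "convex \<Theta>"
    and phi_not_MInf: "\<And>t. t \<in> \<Theta> \<Longrightarrow> \<phi> t \<noteq> -\<infinity>"
    and init_mem: "\<theta> 0 \<in> \<Theta>" and init_finite: "\<phi> (\<theta> 0) < \<infinity>"
    and pos: "0 < \<beta>" "0 < \<eta>x" "\<And>k. 0 < \<eta>\<theta> k"
    and theta_step: "\<And>k. is_arg_min
          (\<lambda>t. \<phi> t + ereal (grad (aug_term K b \<beta> (x k) (y k)) (\<theta> k) \<bullet> (t - \<theta> k)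
                           + 1 / (2 * \<eta>\<theta> k) * (norm (t - \<theta> k))\<^sup>2))
          (\<lambda>t. t \<in> \<Theta>) (\<theta> (Suc k))"
    and x_step: "\<And>k. is_arg_min
          (\<lambda>z. aug_lagrangian \<phi> c K b \<beta> (\<theta> (Suc k)) z (y k) + ereal (1 / (2 * \<eta>x) * (norm (z - x k))\<^sup>2))
          (\<lambda>z. True) (x (Suc k))"
    and y_step: "\<And>k. y (Suc k) = y k + \<beta> *\<^sub>R (K (\<theta> (Suc k)) (x (Suc k)) - b)"
    and grad_lipschitz: "\<And>k. (L k)-lipschitz_on (closed_segment (\<theta> k) (\<theta> (Suc k)))
          (grad (aug_term K b \<beta> (x k) (y k)))"
    and A: "A = 3 * \<kappa> ^ 4 * L\<^sub>K\<^sup>2 * (norm c)\<^sup>2"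
    and B: "B = 3 * \<kappa>\<^sup>2 / \<eta>x\<^sup>2"
begin

abbreviation "h k \<equiv> aug_term K b \<beta> (x k) (y k)"

text \<open>Indexed by the iterate that is left: \<open>\<Delta>\<theta> k\<close> leads from
  iterate \<open>k\<close> to iterate \<open>k + 1\<close>.\<close>

abbreviation "\<Delta>\<theta> k \<equiv> \<theta> (Suc k) - \<theta> k"
abbreviation "\<Delta>x k \<equiv> x (Suc k) - x k"
abbreviation "\<Delta>y k \<equiv> y (Suc k) - y k"

section \<open>Feasibility and finiteness of the iterates\<close>

lemma theta_mem: "\<theta> k \<in> \<Theta>"
  using theta_step[of "k - 1"] init_mem by (cases k) (auto simp: is_arg_min_def)

text \<open>The minimiser of the \<theta>-step is compared with \<open>\<theta> k\<close>, where the
  subproblem has the finite value \<open>\<phi> (\<theta> k)\<close>.\<close>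

lemma phi_finite: "\<bar>\<phi> (\<theta> k)\<bar> \<noteq> \<infinity>"
proof -
  have "\<phi> (\<theta> k) < \<infinity>"
  proof (induction k)
    case (Suc k)
    then show ?case
      using is_arg_min_le[OF theta_step[of k] theta_mem[of k]] by (cases "\<phi> (\<theta> (Suc k))") auto
  qed (rule init_finite)
  then show ?thesis using phi_not_MInf[OF theta_mem[of k]] by auto
qed

definition "f k = real_of_ereal (\<phi> (\<theta> k))"

lemma phi_eq: "\<phi> (\<theta> k) = ereal (f k)"
  using phi_finite by (simp add: f_def ereal_real)

section \<open>Inverse and adjoint of the operator\<close>

lemma linear_K: "linear (K t)"
  by (simp add: blinfun.bounded_linear_right bounded_linear.linear)

lemma inner_adjoint_K: "adjoint (K t) w \<bullet> z = w \<bullet> K t z"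
  using adjoint_works[OF linear_K, of z t w] by (simp add: inner_commute)

lemma K_inv: "t \<in> \<Theta> \<Longrightarrow> K t (inv (K t) w) = w"
  using bij_K by (simp add: bij_def surj_f_inv_f)

lemma inv_K: "t \<in> \<Theta> \<Longrightarrow> inv (K t) (K t z) = z"
  using bij_K by (simp add: bij_def)

lemma linear_inv_K:
  assumes t: "t \<in> \<Theta>"
  shows "linear (inv (K t))"
proof (rule linearI)
  show "inv (K t) (v + w) = inv (K t) v + inv (K t) w" for v w
    using inv_K[OF t, of "inv (K t) v + inv (K t) w"] by (simp add: blinfun.add_right K_inv[OF t])
  show "inv (K t) (a *\<^sub>R v) = a *\<^sub>R inv (K t) v" for a v
    using inv_K[OF t, of "a *\<^sub>R inv (K t) v"] by (simp add: blinfun.scaleR_right K_inv[OF t])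
qed

lemma norm_inv_K_le: "t \<in> \<Theta> \<Longrightarrow> norm (inv (K t) w) \<le> \<kappa> * norm w"
  using onorm[of "inv (K t)" w] onorm_inv_K[of t] linear_inv_K[of t]
  by (meson linear_conv_bounded_linear mult_right_mono norm_ge_zero order_trans)

lemma kappa_nonneg: "0 \<le> \<kappa>"
  using onorm_inv_K[OF init_mem] onorm_pos_le linear_inv_K[OF init_mem]
  by (meson linear_conv_bounded_linear order_trans)

text \<open>The adjoint inherits the bound on the inverse: write \<open>w\<close> as
  \<open>K t (inv (K t) w)\<close> in \<open>w \<bullet> w\<close> and move \<open>K t\<close> to
  the other side.\<close>

lemma norm_le_adjoint_K:
  assumes t: "t \<in> \<Theta>"
  shows "norm w \<le> \<kappa> * norm (adjoint (K t) w)"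
proof (cases "w = 0")
  case False
  have "norm w * norm w = adjoint (K t) w \<bullet> inv (K t) w"
    using t by (simp add: inner_adjoint_K K_inv flip: power2_norm_eq_inner power2_eq_square)
  also have "\<dots> \<le> norm (adjoint (K t) w) * norm (inv (K t) w)" by (rule norm_cauchy_schwarz)
  also have "\<dots> \<le> norm (adjoint (K t) w) * (\<kappa> * norm w)"
    by (intro mult_left_mono norm_inv_K_le t) simp
  finally have "norm w * norm w \<le> (\<kappa> * norm (adjoint (K t) w)) * norm w" by (simp add: mult_ac)
  then show ?thesis using False by (simp add: mult_le_cancel_right)
qed (simp add: kappa_nonneg)

text \<open>The adjoint of the inverse is a right inverse of the adjoint. This supplies the
  comparison multipliers solving \<open>adjoint (K t) u = - c\<close>.\<close>

lemma adjoint_K_surj: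
  assumes t: "t \<in> \<Theta>"
  obtains w where "adjoint (K t) w = z"
proof
  show "adjoint (K t) (adjoint (inv (K t)) z) = z"
  proof (rule vector_eq_rdot[THEN iffD1], rule allI)
    fix v
    show "adjoint (K t) (adjoint (inv (K t)) z) \<bullet> v = z \<bullet> v"
      unfolding inner_adjoint_K using adjoint_works[OF linear_inv_K[OF t], of "K t v" z] t
      by (simp add: inv_K inner_commute)
  qed
qed

lemma linear_adjoint_K: "linear (adjoint (K t))"
  by (rule adjoint_linear[OF linear_K])

lemma norm_K_diff_le:
  assumes "s \<in> \<Theta>" "t \<in> \<Theta>"
  shows "norm (K s z - K t z) \<le> L\<^sub>K * norm (s - t) * norm z"
proof -
  have "norm (K s z - K t z) \<le> norm (K s - K t) * norm z"
    using norm_blinfun[of "K s - K t" z] by (simp add: blinfun.diff_left)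
  also have "\<dots> \<le> L\<^sub>K * norm (s - t) * norm z"
    using lipschitz_onD[OF K_lipschitz assms] by (intro mult_right_mono) (auto simp: dist_norm)
  finally show ?thesis .
qed

text \<open>By duality: the difference \<open>z\<close> is paired with itself, and the Lipschitz
  bound is applied to \<open>K s z - K t z\<close>.\<close>

lemma norm_adjoint_K_diff_le:
  assumes "s \<in> \<Theta>" "t \<in> \<Theta>"
  shows "norm (adjoint (K s) w - adjoint (K t) w) \<le> L\<^sub>K * norm (s - t) * norm w"
proof -
  define z where "z = adjoint (K s) w - adjoint (K t) w"
  show ?thesis
  proof (cases "z = 0")
    case False
    have "norm z * norm z = (adjoint (K s) w - adjoint (K t) w) \<bullet> z"
      by (metis z_def power2_norm_eq_inner power2_eq_square)
    also have "\<dots> = w \<bullet> (K s z - K t z)"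
      by (simp add: inner_diff_left inner_diff_right inner_adjoint_K)
    also have "\<dots> \<le> norm w * norm (K s z - K t z)" by (rule norm_cauchy_schwarz)
    also have "\<dots> \<le> norm w * (L\<^sub>K * norm (s - t) * norm z)"
      by (intro mult_left_mono norm_K_diff_le assms) simp
    finally have "norm z * norm z \<le> (L\<^sub>K * norm (s - t) * norm w) * norm z" by (simp add: mult_ac)
    then show ?thesis using False by (simp add: z_def mult_le_cancel_right)
  qed (use lipschitz_on_nonneg[OF K_lipschitz] in \<open>simp add: z_def\<close>)
qed

text \<open>First-order condition of the unconstrained smooth x-step. The multiplier update turns
  \<open>y k\<close> plus \<beta> times the new primal residual into \<open>y (Suc k)\<close>, so
  only the proximal term remains.\<close>

lemma x_optimality:
  "c + adjoint (K (\<theta> (Suc k))) (y (Suc k)) = - ((1 / \<eta>x) *\<^sub>R \<Delta>x k)"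
proof -
  let ?K = "K (\<theta> (Suc k))" and ?z = "x (Suc k)"
  \<comment> \<open>The value of \<phi> at the new parameter is finite and constant in
    \<open>z\<close>, so it cancels from the comparison.\<close>
  define F where "F z = c \<bullet> z + aug_term K b \<beta> z (y k) (\<theta> (Suc k)) + 1 / (2 * \<eta>x) * (norm (z - x k))\<^sup>2" for z
  have min: "F ?z \<le> F z" for z
    using is_arg_min_le[OF x_step[of k], of z] by (simp add: F_def aug_lagrangian_def phi_eq)
  have D: "(F has_derivative (\<lambda>d. c \<bullet> d + (y k \<bullet> ?K d + \<beta> * ((?K ?z - b) \<bullet> ?K d)) + (1 / \<eta>x) * (\<Delta>x k \<bullet> d))) (at ?z)"
    unfolding F_def aug_term_def power2_norm_eq_inner using pos
    by (auto intro!: derivative_eq_intros bounded_linear.has_derivative[OF blinfun.bounded_linear_right] simp: fun_eq_iff inner_commute field_simps)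
  have "(c \<bullet> d + (y k \<bullet> ?K d + \<beta> * ((?K ?z - b) \<bullet> ?K d)) + (1 / \<eta>x) * (\<Delta>x k \<bullet> d)) = 0" for d
    using differential_zero_maxmin[OF _ open_UNIV D] min by (meson UNIV_I)
  then have "(c + adjoint ?K (y (Suc k)) + (1 / \<eta>x) *\<^sub>R \<Delta>x k) \<bullet> d = 0" for d
    by (simp add: inner_add_left inner_adjoint_K y_step)
  then have "c + adjoint ?K (y (Suc k)) + (1 / \<eta>x) *\<^sub>R \<Delta>x k = 0"
    using inner_eq_zero_iff by blast
  then show ?thesis by (simp add: eq_neg_iff_add_eq_0)
qed

section \<open>Derivatives in the parameter\<close>

abbreviation "DK t \<equiv> frechet_derivative K (at t)"

lemma K_apply_has_derivative:
  assumes "t \<in> \<Theta>"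
  shows "((\<lambda>t. K t z) has_derivative (\<lambda>d. DK t d z)) (at t)"
  using K_differentiable[OF assms] frechet_derivative_works
  by (intro bounded_linear.has_derivative[OF blinfun.bounded_linear_left]) blast

lemma frechet_derivative_K_apply:
  "t \<in> \<Theta> \<Longrightarrow> frechet_derivative (\<lambda>t. K t z) (at t) = (\<lambda>d. DK t d z)"
  by (rule frechet_derivative_at[OF K_apply_has_derivative, symmetric])

lemma inner_adjoint_DK:
  assumes "t \<in> \<Theta>"
  shows "adjoint (\<lambda>d. DK t d z) w \<bullet> d = w \<bullet> DK t d z"
  using adjoint_works[OF has_derivative_linear[OF K_apply_has_derivative[OF assms]], of d z w]
  by (simp add: inner_commute)

text \<open>The adjoint value \<open>a\<close> is paired with itself; \<open>M\<close> bounds the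
  operator \<open>DK t a\<close>, which is then applied to \<open>z\<close>.\<close>

lemma norm_adjoint_DK_le:
  assumes t: "t \<in> \<Theta>" and M: "onorm (DK t) \<le> M"
  shows "norm (adjoint (\<lambda>d. DK t d z) w) \<le> M * norm z * norm w"
proof (cases "adjoint (\<lambda>d. DK t d z) w = 0")
  case True
  have "0 \<le> M"
    using M onorm_pos_le[OF has_derivative_bounded_linear] K_differentiable[OF t] frechet_derivative_works
    by (meson order_trans)
  then show ?thesis using True by simp
next
  case False
  define a where "a = adjoint (\<lambda>d. DK t d z) w"
  have bl: "bounded_linear (DK t)"
    using K_differentiable[OF t] frechet_derivative_works has_derivative_bounded_linear by blast
  have "norm (DK t a) \<le> M * norm a"
    using onorm[OF bl, of a] M by (meson mult_right_mono norm_ge_zero order_trans)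
  then have "norm (DK t a z) \<le> M * norm a * norm z"
    using norm_blinfun[of "DK t a" z] by (meson mult_right_mono norm_ge_zero order_trans)
  moreover have "norm a * norm a = w \<bullet> DK t a z"
    using inner_adjoint_DK[OF t, of z w a] by (simp add: a_def flip: power2_norm_eq_inner power2_eq_square)
  moreover have "w \<bullet> DK t a z \<le> norm w * norm (DK t a z)" by (rule norm_cauchy_schwarz)
  ultimately have "norm a * norm a \<le> norm w * (M * norm a * norm z)"
    by (smt (verit) mult_left_mono norm_ge_zero)
  then have "norm a * norm a \<le> (M * norm z * norm w) * norm a" by (simp add: mult_ac)
  then show ?thesis using False by (simp add: a_def mult_le_cancel_right)
qed

text \<open>Bilinearity in the primal vector and the multiplier, telescoped through the mixed pair
  \<open>z'\<close>, \<open>w\<close>.\<close>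

lemma adjoint_DK_diff:
  assumes "t \<in> \<Theta>"
  shows "adjoint (\<lambda>d. DK t d z) w - adjoint (\<lambda>d. DK t d z') w'
       = adjoint (\<lambda>d. DK t d (z - z')) w + adjoint (\<lambda>d. DK t d z') (w - w')"
  by (rule vector_eq_rdot[THEN iffD1], rule allI)
    (unfold inner_diff_left inner_add_left inner_adjoint_DK[OF assms],
      simp add: blinfun.diff_right inner_diff_right inner_diff_left)

lemma aug_term_gderiv:
  assumes t: "t \<in> \<Theta>"
  shows "GDERIV (aug_term K b \<beta> z w) t :> adjoint (\<lambda>d. DK t d z) (w + \<beta> *\<^sub>R (K t z - b))"
proof -
  define G where "G s = K s z" for s
  have G: "(G has_derivative (\<lambda>d. DK t d z)) (at t)"
    unfolding G_def by (rule K_apply_has_derivative[OF t])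
  have "((\<lambda>s. w \<bullet> (G s - b) + \<beta> / 2 * ((G s - b) \<bullet> (G s - b))) has_derivative
      (\<lambda>d. w \<bullet> DK t d z + \<beta> * ((G t - b) \<bullet> DK t d z))) (at t)"
    by (auto intro!: derivative_eq_intros G simp: fun_eq_iff inner_commute field_simps)
  then have "(aug_term K b \<beta> z w has_derivative
      (\<lambda>d. w \<bullet> DK t d z + \<beta> * ((K t z - b) \<bullet> DK t d z))) (at t)"
    unfolding G_def by (simp add: aug_term_def[abs_def] power2_norm_eq_inner)
  then show ?thesis
    by (simp add: gderiv_def inner_commute[of _ "adjoint _ _"] inner_adjoint_DK[OF t] inner_add_left)
qed

lemma grad_aug_term:
  "t \<in> \<Theta> \<Longrightarrow> grad (aug_term K b \<beta> z w) t = adjoint (\<lambda>d. DK t d z) (w + \<beta> *\<^sub>R (K t z - b))"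
  by (rule grad_eq[OF aug_term_gderiv])

section \<open>Bound on the dual step\<close>

text \<open>With \<open>K\<^sup>T u = - c\<close> at each of the two parameters, the change of \<open>u\<close> accounts for \<open>A\<close> and the two
  deviations \<open>y - u\<close> for \<open>B\<close>; the factor 3 is from \<open>(p + q + r)\<^sup>2 \<le> 3 (p\<^sup>2 + q\<^sup>2 + r\<^sup>2)\<close>.\<close>

lemma norm_dual_step_le:
  "(norm (\<Delta>y (Suc k)))\<^sup>2 \<le>
     A * (norm (\<Delta>\<theta> (Suc k)))\<^sup>2 + B * ((norm (\<Delta>x (Suc k)))\<^sup>2 + (norm (\<Delta>x k))\<^sup>2)"
proof -
  let ?s = "\<theta> (Suc k)" and ?t = "\<theta> (Suc (Suc k))"
  note [simp] = theta_mem
  obtain u where u: "adjoint (K ?s) u = - c" using adjoint_K_surj[of ?s] by auto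
  obtain u' where u': "adjoint (K ?t) u' = - c" using adjoint_K_surj[of ?t] by auto
  have "norm (u' - u) \<le> \<kappa> * norm (adjoint (K ?t) (u' - u))" by (simp add: norm_le_adjoint_K)
  also have "adjoint (K ?t) (u' - u) = adjoint (K ?s) u - adjoint (K ?t) u"
    by (simp add: linear_diff[OF linear_adjoint_K] u u')
  also have "\<kappa> * norm \<dots> \<le> \<kappa> * (L\<^sub>K * norm (?s - ?t) * norm u)"
    by (intro mult_left_mono norm_adjoint_K_diff_le kappa_nonneg) auto
  \<comment> \<open>One factor \<kappa> comes from inverting the adjoint at the new parameter, this
    second one from bounding \<open>u\<close> by \<open>c\<close>; squared, they give the fourth
    power in \<open>A\<close>.\<close>
  also have "\<dots> \<le> \<kappa> * (L\<^sub>K * norm (?s - ?t) * (\<kappa> * norm c))"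
    using norm_le_adjoint_K[of ?s u] lipschitz_on_nonneg[OF K_lipschitz] kappa_nonneg
    by (intro mult_left_mono) (auto simp: u)
  finally have 1: "norm (u' - u) \<le> \<kappa>\<^sup>2 * L\<^sub>K * norm c * norm (\<Delta>\<theta> (Suc k))"
    by (simp add: power2_eq_square mult_ac norm_minus_commute)
  have v: "norm (y (Suc j) - w) \<le> \<kappa> / \<eta>x * norm (\<Delta>x j)" if "adjoint (K (\<theta> (Suc j))) w = - c" for j w
  proof -
    have "adjoint (K (\<theta> (Suc j))) (y (Suc j) - w) = - ((1 / \<eta>x) *\<^sub>R \<Delta>x j)"
      using x_optimality[of j] by (simp add: linear_diff[OF linear_adjoint_K] that add.commute)
    then show ?thesis using norm_le_adjoint_K[of "\<theta> (Suc j)" "y (Suc j) - w"] pos by simp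
  qed
  define p where "p = norm (u' - u)"
  define q where "q = norm (y (Suc (Suc k)) - u')"
  define r where "r = norm (y (Suc k) - u)"
  have "\<Delta>y (Suc k) = (u' - u) + (y (Suc (Suc k)) - u') - (y (Suc k) - u)" by simp
  then have "norm (\<Delta>y (Suc k)) \<le> norm ((u' - u) + (y (Suc (Suc k)) - u')) + r"
    unfolding r_def by (metis norm_triangle_ineq4)
  also have "\<dots> \<le> p + q + r"
    unfolding p_def q_def by (intro add_right_mono norm_triangle_ineq)
  finally have "norm (\<Delta>y (Suc k)) \<le> p + q + r" .
  then have "(norm (\<Delta>y (Suc k)))\<^sup>2 \<le> (p + q + r)\<^sup>2" by (rule power_mono) simp
  also have "\<dots> \<le> 3 * (p\<^sup>2 + q\<^sup>2 + r\<^sup>2)"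
    using zero_le_power2[of "p - q"] zero_le_power2[of "q - r"] zero_le_power2[of "p - r"]
    by (simp add: power2_eq_square algebra_simps)
  also have "\<dots> \<le> 3 * ((\<kappa>\<^sup>2 * L\<^sub>K * norm c * norm (\<Delta>\<theta> (Suc k)))\<^sup>2
      + (\<kappa> / \<eta>x * norm (\<Delta>x (Suc k)))\<^sup>2 + (\<kappa> / \<eta>x * norm (\<Delta>x k))\<^sup>2)"
    unfolding p_def q_def r_def by (intro mult_left_mono add_mono power_mono 1 v u u') auto
  also have "\<dots> = A * (norm (\<Delta>\<theta> (Suc k)))\<^sup>2 + B * ((norm (\<Delta>x (Suc k)))\<^sup>2 + (norm (\<Delta>x k))\<^sup>2)"
    by (simp add: A B power_mult_distrib power_divide algebra_simps flip: power_mult)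
  finally show ?thesis .
qed

section \<open>One-step descent and lower bound of the Lagrangian\<close>

definition "lag k = f k + c \<bullet> x k + h k (\<theta> k)"

lemma aug_lagrangian_eq: "aug_lagrangian \<phi> c K b \<beta> (\<theta> k) (x k) (y k) = ereal (lag k)"
  by (simp add: aug_lagrangian_def phi_eq lag_def)

text \<open>Convexity of \<Theta> keeps the segment feasible, so the descent lemma applies to
  \<open>h k\<close>. Its linear term cancels against the one in the \<theta>-subproblem.\<close>

lemma theta_descent:
  "f (Suc k) + h k (\<theta> (Suc k)) + (1 / (2 * \<eta>\<theta> k) - L k / 2) * (norm (\<Delta>\<theta> k))\<^sup>2 \<le> f k + h k (\<theta> k)"
proof -
  have "GDERIV (h k) t :> grad (h k) t" if "t \<in> closed_segment (\<theta> k) (\<theta> (Suc k))" for t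
  proof -
    have "t \<in> \<Theta>" using that closed_segment_subset[OF theta_mem theta_mem convex_Theta] by blast
    then show ?thesis using aug_term_gderiv grad_aug_term by metis
  qed
  from descent_lemma[OF this grad_lipschitz]
  have "h k (\<theta> (Suc k)) \<le> h k (\<theta> k) + grad (h k) (\<theta> k) \<bullet> \<Delta>\<theta> k + L k / 2 * (norm (\<Delta>\<theta> k))\<^sup>2" .
  moreover have "f (Suc k) + (grad (h k) (\<theta> k) \<bullet> \<Delta>\<theta> k + 1 / (2 * \<eta>\<theta> k) * (norm (\<Delta>\<theta> k))\<^sup>2) \<le> f k"
    using is_arg_min_le[OF theta_step[of k] theta_mem[of k]] by (simp add: phi_eq)
  ultimately show ?thesis by (simp add: algebra_simps)
qed

lemma x_descent:
  "c \<bullet> x (Suc k) + aug_term K b \<beta> (x (Suc k)) (y k) (\<theta> (Suc k)) + 1 / (2 * \<eta>x) * (norm (\<Delta>x k))\<^sup>2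
     \<le> c \<bullet> x k + h k (\<theta> (Suc k))"
  using is_arg_min_le[OF x_step[of k], of "x k"] by (simp add: aug_lagrangian_def phi_eq)

lemma primal_residual: "K (\<theta> (Suc k)) (x (Suc k)) - b = (1 / \<beta>) *\<^sub>R \<Delta>y k"
  using y_step[of k] pos by simp

text \<open>Only the pairing with the multiplier changes, by \<open>\<Delta>y k\<close> times the
  primal residual, which is itself \<open>\<Delta>y k\<close> divided by \<beta>.\<close>

lemma y_ascent:
  "h (Suc k) (\<theta> (Suc k)) = aug_term K b \<beta> (x (Suc k)) (y k) (\<theta> (Suc k)) + 1 / \<beta> * (norm (\<Delta>y k))\<^sup>2"
proof -
  have "y (Suc k) \<bullet> ((1 / \<beta>) *\<^sub>R \<Delta>y k) = y k \<bullet> ((1 / \<beta>) *\<^sub>R \<Delta>y k) + 1 / \<beta> * (norm (\<Delta>y k))\<^sup>2"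
    by (simp add: power2_norm_eq_inner inner_diff_left diff_divide_distrib)
  then show ?thesis unfolding aug_term_def primal_residual by simp
qed

text \<open>Sum of the three block estimates, with the dual ascent replaced by its bound. It starts
  at \<open>Suc k\<close> because both multipliers must come from an x-step for the optimality
  identity to hold.\<close>

lemma lag_descent:
  "lag (Suc (Suc k)) + (1 / (2 * \<eta>\<theta> (Suc k)) - L (Suc k) / 2 - A / \<beta>) * (norm (\<Delta>\<theta> (Suc k)))\<^sup>2
     + (1 / (2 * \<eta>x) - B / \<beta>) * (norm (\<Delta>x (Suc k)))\<^sup>2 - B / \<beta> * (norm (\<Delta>x k))\<^sup>2 \<le> lag (Suc k)"
proof -
  have "1 / \<beta> * (norm (\<Delta>y (Suc k)))\<^sup>2 \<le>
     1 / \<beta> * (A * (norm (\<Delta>\<theta> (Suc k)))\<^sup>2 + B * ((norm (\<Delta>x (Suc k)))\<^sup>2 + (norm (\<Delta>x k))\<^sup>2))"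
    using pos by (intro mult_left_mono norm_dual_step_le) auto
  then show ?thesis
    using theta_descent[of "Suc k"] x_descent[of "Suc k"] y_ascent[of "Suc k"]
    by (simp add: lag_def algebra_simps)
qed

text \<open>Split \<open>x (Suc k)\<close> into \<open>inv ?K b\<close> and \<open>inv ?K w\<close>.
  The optimality identity makes the pairing of \<open>y\<close> with \<open>w\<close> cancel
  \<open>c \<bullet> inv ?K w\<close>; the remaining cross term is absorbed by the penalty.\<close>

lemma lag_lower_bound:
  "f (Suc k) + c \<bullet> inv (K (\<theta> (Suc k))) b \<le> lag (Suc k) + B / \<beta> * (norm (\<Delta>x k))\<^sup>2"
proof -
  let ?K = "K (\<theta> (Suc k))" and ?y = "y (Suc k)"
  define w where "w = ?K (x (Suc k)) - b"
  note mem = theta_mem[of "Suc k"]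
  have x: "x (Suc k) = inv ?K b + inv ?K w"
    using linear_diff[OF linear_inv_K[OF mem]] by (simp add: w_def inv_K[OF mem])
  have "?y \<bullet> w = adjoint ?K ?y \<bullet> inv ?K w" by (simp add: inner_adjoint_K K_inv[OF mem])
  also have "adjoint ?K ?y = - c - (1 / \<eta>x) *\<^sub>R \<Delta>x k"
    using x_optimality[of k] by (simp add: algebra_simps)
  finally have y: "?y \<bullet> w = - (c \<bullet> inv ?K w) - 1 / \<eta>x * (\<Delta>x k \<bullet> inv ?K w)"
    by (simp add: inner_diff_left)
  define n where "n = norm w"
  define e where "e = \<kappa> / \<eta>x * norm (\<Delta>x k)"
  have "\<Delta>x k \<bullet> inv ?K w \<le> norm (\<Delta>x k) * norm (inv ?K w)" by (rule norm_cauchy_schwarz)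
  also have "\<dots> \<le> norm (\<Delta>x k) * (\<kappa> * norm w)" by (intro mult_left_mono norm_inv_K_le mem) simp
  finally have 1: "1 / \<eta>x * (\<Delta>x k \<bullet> inv ?K w) \<le> e * n"
    using pos by (simp add: e_def n_def field_simps)
  \<comment> \<open>Young: \<open>e n \<le> \<beta> n\<^sup>2 / 2 + e\<^sup>2 / (2 \<beta>)\<close>\<close>
  have "0 \<le> (\<beta> * n - e)\<^sup>2" by simp
  then have "2 * \<beta> * (e * n) \<le> \<beta> * (\<beta> * n\<^sup>2) + e\<^sup>2" by (simp add: power2_eq_square algebra_simps)
  then have 2: "e * n \<le> \<beta> / 2 * n\<^sup>2 + e\<^sup>2 / (2 * \<beta>)" using pos by (simp add: field_simps power2_eq_square)
  \<comment> \<open>The constant is enlarged from 1/2 to 3 so that the deficit is expressed by the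
    same \<open>B\<close> that bounds \<tau> from below.\<close>
  have "e\<^sup>2 / (2 * \<beta>) \<le> 3 * e\<^sup>2 / \<beta>" using pos by (simp add: field_simps)
  also have "3 * e\<^sup>2 / \<beta> = B / \<beta> * (norm (\<Delta>x k))\<^sup>2" by (simp add: e_def B power_mult_distrib power_divide)
  finally have 3: "e\<^sup>2 / (2 * \<beta>) \<le> B / \<beta> * (norm (\<Delta>x k))\<^sup>2" .
  have "c \<bullet> x (Suc k) = c \<bullet> inv ?K b + c \<bullet> inv ?K w" by (subst x) (simp add: inner_add_right)
  moreover have "lag (Suc k) = f (Suc k) + c \<bullet> x (Suc k) + (?y \<bullet> w + \<beta> / 2 * n\<^sup>2)"
    by (simp add: lag_def aug_term_def w_def n_def)
  ultimately show ?thesis using y 1 2 3 by linarith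
qed

text \<open>Global minimality in the \<theta>-step, rearranged about the new iterate, is a quadratic
  minorant of the restricted objective.\<close>

lemma theta_stationary:
  "- grad (h k) (\<theta> k) - (1 / \<eta>\<theta> k) *\<^sub>R \<Delta>\<theta> k \<in> limiting_subdiff (restrict_ext \<phi> \<Theta>) (\<theta> (Suc k))"
proof -
  let ?g = "grad (h k) (\<theta> k)" and ?t = "\<theta> (Suc k)"
  have psi: "restrict_ext \<phi> \<Theta> ?t = ereal (f (Suc k))"
    by (simp add: restrict_ext_def set_ind_def theta_mem phi_eq)
  have "- ?g - (1 / \<eta>\<theta> k) *\<^sub>R \<Delta>\<theta> k \<in> regular_subdiff (restrict_ext \<phi> \<Theta>) ?t"
  proof (rule proximal_subgradient_regular[where C = "1 / (2 * \<eta>\<theta> k)"])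
    show "restrict_ext \<phi> \<Theta> ?t + ereal ((- ?g - (1 / \<eta>\<theta> k) *\<^sub>R \<Delta>\<theta> k) \<bullet> (t - ?t)
        - 1 / (2 * \<eta>\<theta> k) * (norm (t - ?t))\<^sup>2) \<le> restrict_ext \<phi> \<Theta> t" for t
    proof (cases "t \<in> \<Theta>")
      case True
      define d where "d = t - ?t"
      define e where "e = 1 / (2 * \<eta>\<theta> k)"
      have t: "t - \<theta> k = d + \<Delta>\<theta> k" and e: "1 / \<eta>\<theta> k = 2 * e" by (simp_all add: d_def e_def)
      \<comment> \<open>Expanding the proximal term about the new iterate: the linear part enters
        the subgradient, the part quadratic in \<open>d\<close> is the allowed error.\<close>
      have "(norm (d + \<Delta>\<theta> k))\<^sup>2 = (norm d)\<^sup>2 + 2 * (\<Delta>\<theta> k \<bullet> d) + (norm (\<Delta>\<theta> k))\<^sup>2"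
        unfolding power2_norm_eq_inner inner_add_left inner_add_right by (simp add: inner_commute)
      then have *: "(- ?g - (1 / \<eta>\<theta> k) *\<^sub>R \<Delta>\<theta> k) \<bullet> (t - ?t) - 1 / (2 * \<eta>\<theta> k) * (norm (t - ?t))\<^sup>2
         = (?g \<bullet> \<Delta>\<theta> k + 1 / (2 * \<eta>\<theta> k) * (norm (\<Delta>\<theta> k))\<^sup>2)
           - (?g \<bullet> (t - \<theta> k) + 1 / (2 * \<eta>\<theta> k) * (norm (t - \<theta> k))\<^sup>2)"
        unfolding t e d_def[symmetric] e_def[symmetric] inner_diff_left[of "- ?g"] inner_add_right
        by (simp add: distrib_left)
      have "ereal (f (Suc k)) + ereal (?g \<bullet> \<Delta>\<theta> k + 1 / (2 * \<eta>\<theta> k) * (norm (\<Delta>\<theta> k))\<^sup>2)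
         \<le> \<phi> t + ereal (?g \<bullet> (t - \<theta> k) + 1 / (2 * \<eta>\<theta> k) * (norm (t - \<theta> k))\<^sup>2)"
        using is_arg_min_le[OF theta_step[of k] True] by (simp add: phi_eq)
      then show ?thesis
        unfolding psi * using True by (cases "\<phi> t") (auto simp: restrict_ext_def set_ind_def)
    qed (simp add: restrict_ext_def set_ind_def)
  qed (simp add: psi)
  then show ?thesis using regular_subdiff_subset_limiting by blast
qed

end

section \<open>Convergence of the residual\<close>

locale convergent_linearized_admm = linearized_admm +
  fixes \<tau> \<eta>low Lbar \<alpha> M m :: real
  assumes tau: "B / \<beta> < \<tau>" "\<tau> < 1 / (2 * \<eta>x) - B / \<beta>"
    and eta_low: "0 < \<eta>low" "\<And>k. \<eta>low \<le> \<eta>\<theta> k"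
    and L_bounded: "\<And>k. L k \<le> Lbar"
    and alpha: "0 < \<alpha>" "\<And>k. \<alpha> \<le> 1 / (2 * \<eta>\<theta> k) - L k / 2 - A / \<beta>"
    and onorm_DK: "\<And>k. onorm (frechet_derivative K (at (\<theta> k))) \<le> M"
    and reduced_bound: "\<And>t. t \<in> \<Theta> \<Longrightarrow> ereal m \<le> \<phi> t + ereal (c \<bullet> inv (K t) b)"
begin

text \<open>Index shift: \<open>merit k\<close> is \<open>\<Phi>\<^sub>k\<^sub>+\<^sub>1\<close>, since \<open>\<Delta>x k\<close> denotes the increment into step \<open>k + 1\<close>.\<close>

definition "merit k = lag (Suc k) + \<tau> * (norm (\<Delta>x k))\<^sup>2"

text \<open>The correction takes \<tau> from the coefficient of the new x-increment and gives it to
  the old one; the two bounds on \<tau> leave both positive.\<close>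

lemma merit_descent:
  "\<alpha> * (norm (\<Delta>\<theta> (Suc k)))\<^sup>2 + (1 / (2 * \<eta>x) - B / \<beta> - \<tau>) * (norm (\<Delta>x (Suc k)))\<^sup>2
     + (\<tau> - B / \<beta>) * (norm (\<Delta>x k))\<^sup>2 \<le> merit k - merit (Suc k)"
proof -
  have "\<alpha> * (norm (\<Delta>\<theta> (Suc k)))\<^sup>2
      \<le> (1 / (2 * \<eta>\<theta> (Suc k)) - L (Suc k) / 2 - A / \<beta>) * (norm (\<Delta>\<theta> (Suc k)))\<^sup>2"
    by (intro mult_right_mono alpha) simp
  then show ?thesis using lag_descent[of k] by (simp add: merit_def left_diff_distrib)
qed

lemma merit_lower_bound: "m \<le> merit k"
proof -
  have "m \<le> f (Suc k) + c \<bullet> inv (K (\<theta> (Suc k))) b"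
    using reduced_bound[OF theta_mem[of "Suc k"]] by (simp add: phi_eq)
  also have "\<dots> \<le> lag (Suc k) + B / \<beta> * (norm (\<Delta>x k))\<^sup>2" by (rule lag_lower_bound)
  also have "\<dots> \<le> merit k"
    unfolding merit_def using tau by (intro add_left_mono mult_right_mono) auto
  finally show ?thesis .
qed

text \<open>The merit is decreasing and bounded below, hence its decrements vanish, and each
  weighted squared primal increment lies below a decrement.\<close>

lemma increments_tendsto_0:
  "(\<lambda>k. norm (\<Delta>\<theta> k)) \<longlonglongrightarrow> 0" "(\<lambda>k. norm (\<Delta>x k)) \<longlonglongrightarrow> 0" "(\<lambda>k. norm (\<Delta>y k)) \<longlonglongrightarrow> 0"
proof -
  have nonneg: "0 \<le> \<alpha> * (norm (\<Delta>\<theta> (Suc k)))\<^sup>2" "0 \<le> (1 / (2 * \<eta>x) - B / \<beta> - \<tau>) * (norm (\<Delta>x (Suc k)))\<^sup>2"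
    "0 \<le> (\<tau> - B / \<beta>) * (norm (\<Delta>x k))\<^sup>2" for k
    using alpha tau by auto
  have "decseq merit"
    using merit_descent nonneg by (intro decseq_SucI) (smt (verit))
  then obtain l where l: "merit \<longlonglongrightarrow> l"
    using decseq_convergent[of merit m] merit_lower_bound by blast
  have "(\<lambda>k. merit k - merit (Suc k)) \<longlonglongrightarrow> l - l"
    by (intro tendsto_diff l LIMSEQ_Suc)
  then have gap: "(\<lambda>k. merit k - merit (Suc k)) \<longlonglongrightarrow> 0" by simp
  have root: "(\<lambda>k. norm (v k)) \<longlonglongrightarrow> 0" if "(\<lambda>k. e * (norm (v k))\<^sup>2) \<longlonglongrightarrow> 0" "0 < e"
    for e and v :: "nat \<Rightarrow> 'z::real_normed_vector"
  proof -
    have "(\<lambda>k. sqrt (1 / e * (e * (norm (v k))\<^sup>2))) \<longlonglongrightarrow> sqrt (1 / e * 0)"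
      by (intro tendsto_intros that)
    then show ?thesis using that by simp
  qed
  have "(\<lambda>k. \<alpha> * (norm (\<Delta>\<theta> (Suc k)))\<^sup>2) \<longlonglongrightarrow> 0"
    by (rule tendsto_sandwich[OF _ _ tendsto_const gap])
      (intro always_eventually allI, use merit_descent nonneg in \<open>smt (verit)\<close>)+
  from root[OF this alpha(1)] show \<theta>: "(\<lambda>k. norm (\<Delta>\<theta> k)) \<longlonglongrightarrow> 0"
    by (rule LIMSEQ_imp_Suc)
  \<comment> \<open>The term with the old increment is used, so no index shift is required
    here.\<close>
  have "(\<lambda>k. (\<tau> - B / \<beta>) * (norm (\<Delta>x k))\<^sup>2) \<longlonglongrightarrow> 0"
    by (rule tendsto_sandwich[OF _ _ tendsto_const gap])
      (intro always_eventually allI, use merit_descent nonneg in \<open>smt (verit)\<close>)+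
  from root[OF this] tau show x: "(\<lambda>k. norm (\<Delta>x k)) \<longlonglongrightarrow> 0" by simp
  \<comment> \<open>Dual increments are absent from the merit decrease; they vanish because the
    dual-step bound does.\<close>
  have "(\<lambda>k. A * (norm (\<Delta>\<theta> (Suc k)))\<^sup>2 + B * ((norm (\<Delta>x (Suc k)))\<^sup>2 + (norm (\<Delta>x k))\<^sup>2))
      \<longlonglongrightarrow> A * 0\<^sup>2 + B * (0\<^sup>2 + 0\<^sup>2)"
    by (intro tendsto_intros LIMSEQ_Suc[OF \<theta>] LIMSEQ_Suc[OF x] x)
  then have "(\<lambda>k. A * (norm (\<Delta>\<theta> (Suc k)))\<^sup>2 + B * ((norm (\<Delta>x (Suc k)))\<^sup>2 + (norm (\<Delta>x k))\<^sup>2)) \<longlonglongrightarrow> 0"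
    by simp
  then have "(\<lambda>k. 1 * (norm (\<Delta>y (Suc k)))\<^sup>2) \<longlonglongrightarrow> 0"
    by (rule tendsto_sandwich[OF _ _ tendsto_const, rotated 2]) (auto intro!: always_eventually norm_dual_step_le)
  from root[OF this zero_less_one] show "(\<lambda>k. norm (\<Delta>y k)) \<longlonglongrightarrow> 0"
    by (rule LIMSEQ_imp_Suc)
qed

section \<open>Bounds on the iterates and on the residual\<close>

lemma norm_y_le: "norm (y (Suc k)) \<le> \<kappa> * (norm c + norm (\<Delta>x k) / \<eta>x)"
proof -
  have "adjoint (K (\<theta> (Suc k))) (y (Suc k)) = - (c + (1 / \<eta>x) *\<^sub>R \<Delta>x k)"
    using x_optimality[of k] by (simp add: algebra_simps)
  then have "norm (adjoint (K (\<theta> (Suc k))) (y (Suc k))) = norm (c + (1 / \<eta>x) *\<^sub>R \<Delta>x k)"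
    by (simp only: norm_minus_cancel)
  also have "\<dots> \<le> norm c + norm (\<Delta>x k) / \<eta>x"
    using norm_triangle_ineq[of c "(1 / \<eta>x) *\<^sub>R \<Delta>x k"] pos by simp
  finally show ?thesis
    using norm_le_adjoint_K[OF theta_mem, of "y (Suc k)" "Suc k"] kappa_nonneg
    by (meson mult_left_mono order_trans)
qed

lemma norm_x_le: "norm (x (Suc k)) \<le> \<kappa> * (norm b + norm (\<Delta>y k) / \<beta>)"
proof -
  have "x (Suc k) = inv (K (\<theta> (Suc k))) (b + (1 / \<beta>) *\<^sub>R \<Delta>y k)"
    by (simp add: inv_K theta_mem flip: primal_residual)
  then have "norm (x (Suc k)) \<le> \<kappa> * norm (b + (1 / \<beta>) *\<^sub>R \<Delta>y k)"
    by (metis norm_inv_K_le theta_mem)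
  also have "\<dots> \<le> \<kappa> * (norm b + norm (\<Delta>y k) / \<beta>)"
    using norm_triangle_ineq[of b "(1 / \<beta>) *\<^sub>R \<Delta>y k"] pos
    by (intro mult_left_mono kappa_nonneg) simp
  finally show ?thesis .
qed

text \<open>Works without a bound on the norm of \<open>K\<close>: the image of the increment is the
  difference of two primal residuals, corrected by the change of \<open>K\<close> on
  \<open>x (Suc k)\<close>.\<close>

lemma norm_K_x_increment_le:
  "norm (K (\<theta> (Suc (Suc k))) (\<Delta>x (Suc k)))
     \<le> norm (\<Delta>y (Suc k)) / \<beta> + L\<^sub>K * norm (\<Delta>\<theta> (Suc k)) * norm (x (Suc k)) + norm (\<Delta>y k) / \<beta>"
proof -
  let ?s = "\<theta> (Suc k)" and ?t = "\<theta> (Suc (Suc k))"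
  have "K ?t (\<Delta>x (Suc k)) = (1 / \<beta>) *\<^sub>R \<Delta>y (Suc k) - (K ?t (x (Suc k)) - K ?s (x (Suc k))) - (1 / \<beta>) *\<^sub>R \<Delta>y k"
    by (simp add: blinfun.diff_right flip: primal_residual)
  then have "norm (K ?t (\<Delta>x (Suc k))) \<le> norm ((1 / \<beta>) *\<^sub>R \<Delta>y (Suc k))
      + norm (K ?t (x (Suc k)) - K ?s (x (Suc k))) + norm ((1 / \<beta>) *\<^sub>R \<Delta>y k)"
    by (simp only:) (intro order_trans[OF norm_triangle_ineq4] add_right_mono norm_triangle_ineq4)
  then show ?thesis
    using norm_K_diff_le[OF theta_mem[of "Suc (Suc k)"] theta_mem[of "Suc k"], of "x (Suc k)"] pos by simp
qed

text \<open>The subgradient from the \<theta>-step plus the coupling gradient at the new iterate: a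
  member of the set whose distance to zero enters the residual.\<close>

definition "stationarity_gap k = - grad (h k) (\<theta> k) - (1 / \<eta>\<theta> k) *\<^sub>R \<Delta>\<theta> k
  + adjoint (\<lambda>d. DK (\<theta> (Suc k)) d (x (Suc k))) (y (Suc k))"

text \<open>The gradient Lipschitz hypothesis moves \<open>\<nabla>h\<^sub>k\<close> from \<open>\<theta>\<^sup>k\<close> to \<open>\<theta>\<^sup>k\<^sup>+\<^sup>1\<close>; there only the
  arguments of the same derivative of \<open>K\<close> differ, so its continuity is not needed.\<close>

lemma norm_stationarity_gap_le:
  "norm (stationarity_gap k) \<le> Lbar * norm (\<Delta>\<theta> k) + norm (\<Delta>\<theta> k) / \<eta>low
     + M * norm (\<Delta>x k) * norm (y (Suc k)) + M * norm (x k) * (\<beta> * norm (K (\<theta> (Suc k)) (\<Delta>x k)))"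
proof -
  let ?t = "\<theta> (Suc k)"
  note mem = theta_mem[of "Suc k"]
  \<comment> \<open>The effective multiplier in the gradient of \<open>h k\<close> at the new
    parameter differs from \<open>y (Suc k)\<close> only because it uses the old
    \<open>x k\<close>.\<close>
  have "y k + \<beta> *\<^sub>R (K ?t (x k) - b) = y (Suc k) - \<beta> *\<^sub>R K ?t (\<Delta>x k)"
    by (simp add: y_step blinfun.diff_right algebra_simps)
  then have "grad (h k) ?t = adjoint (\<lambda>d. DK ?t d (x k)) (y (Suc k) - \<beta> *\<^sub>R K ?t (\<Delta>x k))"
    by (simp add: grad_aug_term[OF mem])
  then have "adjoint (\<lambda>d. DK ?t d (x (Suc k))) (y (Suc k)) = grad (h k) ?t
      + adjoint (\<lambda>d. DK ?t d (\<Delta>x k)) (y (Suc k)) + adjoint (\<lambda>d. DK ?t d (x k)) (\<beta> *\<^sub>R K ?t (\<Delta>x k))"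
    using adjoint_DK_diff[OF mem, of "x (Suc k)" "y (Suc k)" "x k" "y (Suc k) - \<beta> *\<^sub>R K ?t (\<Delta>x k)"]
    by (simp add: algebra_simps)
  then have "stationarity_gap k = (grad (h k) ?t - grad (h k) (\<theta> k)) + (- (1 / \<eta>\<theta> k) *\<^sub>R \<Delta>\<theta> k)
      + adjoint (\<lambda>d. DK ?t d (\<Delta>x k)) (y (Suc k)) + adjoint (\<lambda>d. DK ?t d (x k)) (\<beta> *\<^sub>R K ?t (\<Delta>x k))"
    by (simp add: stationarity_gap_def)
  then have "norm (stationarity_gap k) \<le> norm (grad (h k) ?t - grad (h k) (\<theta> k)) + norm (- (1 / \<eta>\<theta> k) *\<^sub>R \<Delta>\<theta> k)
      + norm (adjoint (\<lambda>d. DK ?t d (\<Delta>x k)) (y (Suc k)))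
      + norm (adjoint (\<lambda>d. DK ?t d (x k)) (\<beta> *\<^sub>R K ?t (\<Delta>x k)))"
    by (simp only:) (intro norm_triangle_le add_right_mono norm_triangle_ineq)
  also have "\<dots> \<le> Lbar * norm (\<Delta>\<theta> k) + norm (\<Delta>\<theta> k) / \<eta>low
     + M * norm (\<Delta>x k) * norm (y (Suc k)) + M * norm (x k) * norm (\<beta> *\<^sub>R K ?t (\<Delta>x k))"
  proof (intro add_mono norm_adjoint_DK_le mem onorm_DK)
    have "norm (grad (h k) ?t - grad (h k) (\<theta> k)) \<le> L k * norm (\<Delta>\<theta> k)"
      using lipschitz_onD[OF grad_lipschitz[of k], of ?t "\<theta> k"] by (simp add: dist_norm)
    also have "\<dots> \<le> Lbar * norm (\<Delta>\<theta> k)" by (intro mult_right_mono L_bounded) simp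
    finally show "norm (grad (h k) ?t - grad (h k) (\<theta> k)) \<le> Lbar * norm (\<Delta>\<theta> k)" .
    show "norm (- (1 / \<eta>\<theta> k) *\<^sub>R \<Delta>\<theta> k) \<le> norm (\<Delta>\<theta> k) / \<eta>low"
      using pos(3)[of k] eta_low(1) eta_low(2)[of k] by (simp add: divide_left_mono)
  qed
  finally show ?thesis using pos by simp
qed

text \<open>The gap is one candidate in the infimum; the other two residual parts are scaled
  increments exactly, by x-optimality and the multiplier update.\<close>

lemma kkt_residual_le:
  "kkt_residual \<phi> \<Theta> c K b (\<theta> (Suc k)) (x (Suc k)) (y (Suc k)) \<le>
    ereal ((norm (stationarity_gap k))\<^sup>2 + (norm (\<Delta>x k) / \<eta>x)\<^sup>2 + (norm (\<Delta>y k) / \<beta>)\<^sup>2)"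
proof -
  have "stationarity_gap k \<in> (\<lambda>v. v + adjoint (frechet_derivative (\<lambda>t. K t (x (Suc k))) (at (\<theta> (Suc k)))) (y (Suc k)))
      ` limiting_subdiff (restrict_ext \<phi> \<Theta>) (\<theta> (Suc k))"
    unfolding stationarity_gap_def frechet_derivative_K_apply[OF theta_mem]
    by (rule imageI[OF theta_stationary])
  from square_ext_infdist_le[OF this] show ?thesis
    unfolding kkt_residual_def x_optimality primal_residual using pos
    by (auto simp flip: plus_ereal.simps intro!: add_mono)
qed

lemma kkt_residual_nonneg: "0 \<le> kkt_residual \<phi> \<Theta> c K b t z w"
  unfolding kkt_residual_def power2_eq_square
  by (intro add_nonneg_nonneg ereal_0_le_mult ext_infdist_nonneg) auto

lemma kkt_residual_tendsto_0: "(\<lambda>k. kkt_residual \<phi> \<Theta> c K b (\<theta> k) (x k) (y k)) \<longlonglongrightarrow> 0"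
proof -
  define T where "T k = norm (\<Delta>\<theta> k)" for k
  define X where "X k = norm (\<Delta>x k)" for k
  define Y where "Y k = norm (\<Delta>y k)" for k
  \<comment> \<open>\<open>xb k\<close> and \<open>yb k\<close> dominate the norms of
    \<open>x (Suc k)\<close> and \<open>y (Suc k)\<close> and, unlike these norms, are known to
    converge.\<close>
  define xb where "xb k = \<kappa> * (norm b + Y k / \<beta>)" for k
  define yb where "yb k = \<kappa> * (norm c + X k / \<eta>x)" for k
  \<comment> \<open>Majorant of the gap at \<open>Suc k\<close>, where the bound on the preceding
    \<open>x\<close> is available; every summand carries a vanishing factor.\<close>
  define R where "R k = Lbar * T (Suc k) + T (Suc k) / \<eta>low + M * X (Suc k) * yb (Suc k)
     + M * xb k * (\<beta> * (Y (Suc k) / \<beta> + L\<^sub>K * T (Suc k) * xb k + Y k / \<beta>))" for k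
  note lim = increments_tendsto_0[folded T_def X_def Y_def]
  have M: "0 \<le> M"
    using onorm_DK[of 0] onorm_pos_le[OF has_derivative_bounded_linear] K_differentiable[OF theta_mem]
      frechet_derivative_works by (meson order_trans)
  have gap: "norm (stationarity_gap (Suc k)) \<le> R k" for k
  proof -
    have LK: "0 \<le> L\<^sub>K" by (rule lipschitz_on_nonneg[OF K_lipschitz])
    have x: "norm (x (Suc k)) \<le> xb k" and y: "norm (y (Suc (Suc k))) \<le> yb (Suc k)"
      using norm_x_le norm_y_le by (simp_all add: xb_def yb_def X_def Y_def)
    have "norm (K (\<theta> (Suc (Suc k))) (\<Delta>x (Suc k))) \<le> Y (Suc k) / \<beta> + L\<^sub>K * T (Suc k) * norm (x (Suc k)) + Y k / \<beta>"
      using norm_K_x_increment_le[of k] by (simp add: Y_def T_def)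
    also have "\<dots> \<le> Y (Suc k) / \<beta> + L\<^sub>K * T (Suc k) * xb k + Y k / \<beta>"
      using LK by (intro add_mono mult_left_mono x) (auto simp: T_def)
    finally have Kx: "norm (K (\<theta> (Suc (Suc k))) (\<Delta>x (Suc k))) \<le> Y (Suc k) / \<beta> + L\<^sub>K * T (Suc k) * xb k + Y k / \<beta>" .
    have xb: "0 \<le> xb k" using x norm_ge_zero order_trans by blast
    show ?thesis
      unfolding R_def T_def[of "Suc k"] X_def[of "Suc k"]
      by (rule order_trans[OF norm_stationarity_gap_le], intro add_mono mult_mono order_refl x y
          mult_left_mono Kx[unfolded T_def[of "Suc k"]]) (use M pos xb in auto)
  qed
  have "R \<longlonglongrightarrow> Lbar * 0 + 0 / \<eta>low + M * 0 * (\<kappa> * (norm c + 0 / \<eta>x))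
     + M * (\<kappa> * (norm b + 0 / \<beta>)) * (\<beta> * (0 / \<beta> + L\<^sub>K * 0 * (\<kappa> * (norm b + 0 / \<beta>)) + 0 / \<beta>))"
    unfolding R_def xb_def yb_def
    using pos eta_low by (intro tendsto_intros lim lim[THEN LIMSEQ_Suc]) auto
  then have "R \<longlonglongrightarrow> 0" by simp
  then have "(\<lambda>k. (R k)\<^sup>2 + (X (Suc k) / \<eta>x)\<^sup>2 + (Y (Suc k) / \<beta>)\<^sup>2) \<longlonglongrightarrow> 0\<^sup>2 + (0 / \<eta>x)\<^sup>2 + (0 / \<beta>)\<^sup>2"
    using pos by (intro tendsto_intros lim[THEN LIMSEQ_Suc]) auto
  then have up: "(\<lambda>k. ereal ((R k)\<^sup>2 + (X (Suc k) / \<eta>x)\<^sup>2 + (Y (Suc k) / \<beta>)\<^sup>2)) \<longlonglongrightarrow> 0"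
    by (simp add: zero_ereal_def)
  \<comment> \<open>The residual at \<open>Suc (Suc k)\<close> is controlled by the gap at
    \<open>Suc k\<close>; the shift by two is undone at the end.\<close>
  have "(\<lambda>k. kkt_residual \<phi> \<Theta> c K b (\<theta> (Suc (Suc k))) (x (Suc (Suc k))) (y (Suc (Suc k)))) \<longlonglongrightarrow> 0"
  proof (rule tendsto_sandwich[OF _ _ tendsto_const up]; intro always_eventually allI)
    fix k
    show "0 \<le> kkt_residual \<phi> \<Theta> c K b (\<theta> (Suc (Suc k))) (x (Suc (Suc k))) (y (Suc (Suc k)))"
      by (rule kkt_residual_nonneg)
    show "kkt_residual \<phi> \<Theta> c K b (\<theta> (Suc (Suc k))) (x (Suc (Suc k))) (y (Suc (Suc k)))
        \<le> ereal ((R k)\<^sup>2 + (X (Suc k) / \<eta>x)\<^sup>2 + (Y (Suc k) / \<beta>)\<^sup>2)"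
      using power_mono[OF gap[of k], of 2]
      by (intro order_trans[OF kkt_residual_le]) (simp add: X_def Y_def)
  qed
  from LIMSEQ_imp_Suc[OF LIMSEQ_imp_Suc[OF this]] show ?thesis .
qed

end

theorem theoremG5:
  fixes P :: "'s::finite \<Rightarrow> 'a::finite \<Rightarrow> 's \<Rightarrow> real"
    and r :: "'s \<Rightarrow> 'a \<Rightarrow> real"
    and \<rho> :: "'s \<Rightarrow> real"
    and \<gamma> :: real
    and \<Theta> :: "(real^'p) set"
    and \<pi> :: "real^'p \<Rightarrow> 's \<Rightarrow> 'a \<Rightarrow> real"
    and \<phi> :: "real^'p \<Rightarrow> ereal"
    and K :: "real^'p \<Rightarrow> ((real^('s \<times> 'a)) \<times> (real^'s)) \<Rightarrow>\<^sub>L ((real^'s) \<times> (real^('s \<times> 'a)))"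
    and b :: "(real^'s) \<times> (real^('s \<times> 'a))"
    and c :: "(real^('s \<times> 'a)) \<times> (real^'s)"
    and \<beta> \<eta>x :: real
    and \<eta>\<theta> :: "nat \<Rightarrow> real"
    and \<theta> :: "nat \<Rightarrow> real^'p"
    and x :: "nat \<Rightarrow> (real^('s \<times> 'a)) \<times> (real^'s)"
    and y :: "nat \<Rightarrow> (real^'s) \<times> (real^('s \<times> 'a))"
    and h :: "nat \<Rightarrow> real^'p \<Rightarrow> real"
    and L\<^sub>K \<kappa> A B \<tau> \<eta>low Lbar \<alpha> :: real
    and L :: "nat \<Rightarrow> real"
    and \<Phi> :: "nat \<Rightarrow> ereal"
  assumes mdp: "finite_mdp P \<rho> \<gamma>"
    and Theta: "closed \<Theta>" "convex \<Theta>"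
    and policy: "smooth_policy_map \<Theta> \<pi>"
    and psi: "proper (restrict_ext \<phi> \<Theta>)" "lsc (restrict_ext \<phi> \<Theta>)"
             "bounded_below_on UNIV (restrict_ext \<phi> \<Theta>)"
    and K: "K = occ_K \<gamma> P \<pi>"
    and b: "b = occ_b \<gamma> \<rho>"
    and c: "c = occ_c \<gamma> r"
    and pos: "0 < \<beta>" "0 < \<eta>x" "\<And>k. 0 < \<eta>\<theta> k"
    and h: "\<And>k. h k = aug_term K b \<beta> (x k) (y k)"
    and init: "\<theta> 0 \<in> edom (restrict_ext \<phi> \<Theta>)"
    and theta_step: "\<And>k. is_arg_min
          (\<lambda>t. \<phi> t + ereal (grad (h k) (\<theta> k) \<bullet> (t - \<theta> k) + 1 / (2 * \<eta>\<theta> k) * (norm (t - \<theta> k))\<^sup>2))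
          (\<lambda>t. t \<in> \<Theta>) (\<theta> (Suc k))"
    and x_step: "\<And>k. is_arg_min
          (\<lambda>z. aug_lagrangian \<phi> c K b \<beta> (\<theta> (Suc k)) z (y k) + ereal (1 / (2 * \<eta>x) * (norm (z - x k))\<^sup>2))
          (\<lambda>z. True) (x (Suc k))"
    and y_step: "\<And>k. y (Suc k) = y k + \<beta> *\<^sub>R (blinfun_apply (K (\<theta> (Suc k))) (x (Suc k)) - b)"
    and K_lipschitz: "L\<^sub>K-lipschitz_on \<Theta> K"
    and DK_bounded: "\<exists>M. \<forall>k. onorm (frechet_derivative K (at (\<theta> k))) \<le> M"
    and reduced: "bounded_below_on \<Theta> (\<lambda>t. \<phi> t + ereal (c \<bullet> inv (blinfun_apply (K t)) b))"
    and kappa: "\<kappa> = (SUP t\<in>\<Theta>. onorm (inv (blinfun_apply (K t))))"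
    and A: "A = 3 * \<kappa> ^ 4 * L\<^sub>K\<^sup>2 * (norm c)\<^sup>2"
    and B: "B = 3 * \<kappa>\<^sup>2 / \<eta>x\<^sup>2"
    and tau: "B / \<beta> < \<tau>" "\<tau> < 1 / (2 * \<eta>x) - B / \<beta>"
    and eta_low: "0 < \<eta>low" "\<And>k. \<eta>low \<le> \<eta>\<theta> k"
    and grad_lipschitz: "\<And>k. (L k)-lipschitz_on (closed_segment (\<theta> k) (\<theta> (Suc k))) (grad (h k))"
    and L_bounded: "\<And>k. L k \<le> Lbar"
    and alpha: "0 < \<alpha>" "\<And>k. \<alpha> \<le> 1 / (2 * \<eta>\<theta> k) - L k / 2 - A / \<beta>"
    and Phi: "\<And>k. 1 \<le> k \<Longrightarrow>
          \<Phi> k = aug_lagrangian \<phi> c K b \<beta> (\<theta> k) (x k) (y k) + ereal (\<tau> * (norm (x k - x (k - 1)))\<^sup>2)"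
  shows "(\<forall>k\<ge>1. \<bar>\<Phi> k\<bar> \<noteq> \<infinity>) \<and>
         (\<exists>c1 c2 c3. 0 < c1 \<and> 0 < c2 \<and> 0 < c3 \<and>
            (\<forall>k\<ge>1. \<Phi> k - \<Phi> (Suc k) \<ge>
               ereal (c1 * (norm (\<theta> (Suc k) - \<theta> k))\<^sup>2 + c2 * (norm (x (Suc k) - x k))\<^sup>2
                      + c3 * (norm (x k - x (k - 1)))\<^sup>2))) \<and>
         ((\<lambda>k. kkt_residual \<phi> \<Theta> c K b (\<theta> k) (x k) (y k)) \<longlonglongrightarrow> 0)"
proof -
  have K_diff: "K differentiable at t" if "t \<in> \<Theta>" for t
    unfolding K by (intro differentiable_occ_K differentiable_smooth_policy_map[OF policy that])
  have bij: "bij (K t)" if "t \<in> \<Theta>" for t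
    unfolding K by (rule bij_occ_K[OF mdp policy that])
  have inv_le: "onorm (inv (K t)) \<le> \<kappa>" if "t \<in> \<Theta>" for t
    unfolding kappa using bdd_above_inv_occ_K[OF mdp policy] that
    by (intro cSUP_upper) (simp_all add: K)
  have psi_eq: "restrict_ext \<phi> \<Theta> t = \<phi> t" if "t \<in> \<Theta>" for t
    using that by (simp add: restrict_ext_def set_ind_def)
  \<comment> \<open>On \<Theta> the restricted objective agrees with \<phi>, so its properness
    excludes \<open>-\<infinity>\<close> there.\<close>
  have phi: "\<phi> t \<noteq> -\<infinity>" if "t \<in> \<Theta>" for t
    using psi(1) psi_eq[OF that] unfolding proper_def by metis
  have init_mem: "\<theta> 0 \<in> \<Theta>"
    using init by (auto simp: edom_def restrict_ext_def set_ind_def split: if_splits)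
  have init_fin: "\<phi> (\<theta> 0) < \<infinity>"
    using init psi_eq[OF init_mem] by (simp add: edom_def)
  obtain M where M: "\<And>k. onorm (frechet_derivative K (at (\<theta> k))) \<le> M"
    using DK_bounded by blast
  obtain m where m: "\<And>t. t \<in> \<Theta> \<Longrightarrow> ereal m \<le> \<phi> t + ereal (c \<bullet> inv (K t) b)"
    using reduced unfolding bounded_below_on_def by blast
  interpret convergent_linearized_admm \<Theta> \<phi> K b c \<beta> \<eta>x \<eta>\<theta> \<theta> x y L\<^sub>K \<kappa> A B L \<tau> \<eta>low Lbar \<alpha> M m
    by unfold_locales (fact K_diff bij inv_le K_lipschitz Theta phi init_mem init_fin pos
        theta_step[unfolded h] x_step y_step grad_lipschitz[unfolded h] A B tau eta_low L_bounded
        alpha M m)+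
  have Phi_Suc: "\<Phi> (Suc k) = ereal (merit k)" for k
    using Phi[of "Suc k"] by (simp add: aug_lagrangian_eq merit_def)
  have decrease: "ereal (\<alpha> * (norm (\<theta> (Suc k) - \<theta> k))\<^sup>2
      + (1 / (2 * \<eta>x) - B / \<beta> - \<tau>) * (norm (x (Suc k) - x k))\<^sup>2
      + (\<tau> - B / \<beta>) * (norm (x k - x (k - 1)))\<^sup>2) \<le> \<Phi> k - \<Phi> (Suc k)" if k: "1 \<le> k" for k
  proof -
    \<comment> \<open>With \<open>k = Suc j\<close> the previous increment, written with
      \<open>k - 1\<close>, becomes \<open>\<Delta>x j\<close>.\<close>
    obtain j where "k = Suc j" using k by (cases k) auto
    then show ?thesis using merit_descent[of j] by (simp add: Phi_Suc)
  qed
  have "\<bar>\<Phi> k\<bar> \<noteq> \<infinity>" if "1 \<le> k" for k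
    using that Phi_Suc[of "k - 1"] by simp
  \<comment> \<open>The witnesses are \<alpha> and the two slacks in the bounds on \<tau>.\<close>
  then show ?thesis
    using decrease alpha(1) tau kkt_residual_tendsto_0
    by (intro conjI allI impI exI[of _ \<alpha>] exI[of _ "1 / (2 * \<eta>x) - B / \<beta> - \<tau>"]
        exI[of _ "\<tau> - B / \<beta>"]) auto
qed

end
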